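(* Let $d\ge 1$ and let $\omega$ be a weight function. Then the space $\mathcal{S}_\omega(\mathbb{R}^d)$ is nuclear.
   Context: A weight function is a continuous increasing function $\omega:[0,+\infty)\to[0,+\infty)$ such that: $(\alpha)$ there is $L\ge 1$ with $\omega(2t)\le L(\omega(t)+1)$ for all $t\ge 0$; $(\beta)$ $\omega(t)=o(t)$ as $t\to+\infty$; $(\gamma)$ there are $a\in\mathbb{R}$, $b>0$ with $\omega(t)\ge a+b\log(1+t)$ for all $t\ge 0$; $(\delta)$ the map $t\mapsto\omega(e^t)$ is convex. For a vector $\zeta$ one writes $\omega(\zeta):=\omega(|\zeta|)$, with $|\cdot|$ the Euclidean norm. The Fourier transform is $\hat u(\xi)=\int_{\mathbb{R}^d}u(x)e^{-i\langle x,\xi\rangle}dx$. The space $\mathcal{S}_\omega(\mathbb{R}^d)$ is the set of all $u\in L^1(\mathbb{R}^d)$ such that $u,\hat u\in C^\infty(\mathbb{R}^d)$ and, for each $\lambda>0$ and each $\alpha\in\mathbb{N}_0^d$, $\sup_{x\in\mathbb{R}^d}e^{\lambda\omega(x)}|\partial^\alpha u(x)|<+\infty$ and $\sup_{\xi\in\mathbb{R}^d}e^{\lambda\omega(\xi)}|\partial^\alpha\hat u(\xi)|<+\infty$. It carries the locally convex (Fréchet) topology given by these seminorms ($\lambda>0$, $\alpha\in\mathbb{N}_0^d$). *)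

theory Defs
  imports
    "HOL-Analysis.Analysis"
    "HOL-Library.Function_Algebras"
    "HOL-Library.Landau_Symbols"
begin

text \<open>Only the values of \<open>\<omega>\<close> on \<open>{0..}\<close> matter; ``increasing'' is read as nondecreasing.\<close>

definition weight_function :: "(real \<Rightarrow> real) \<Rightarrow> bool" where
  "weight_function \<omega> \<longleftrightarrow>
     continuous_on {0..} \<omega> \<and> mono_on {0..} \<omega> \<and> (\<forall>t\<ge>0. 0 \<le> \<omega> t) \<and>
     (\<exists>L\<ge>1. \<forall>t\<ge>0. \<omega> (2 * t) \<le> L * (\<omega> t + 1)) \<and>
     \<omega> \<in> o[at_top](\<lambda>t. t) \<and>
     (\<exists>a. \<exists>b>0. \<forall>t\<ge>0. \<omega> t \<ge> a + b * ln (1 + t)) \<and>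
     convex_on UNIV (\<lambda>t. \<omega> (exp t))"


section \<open>Smooth functions on \<open>real ^ 'n\<close>\<close>

definition partial_deriv ::
    "'n \<Rightarrow> (real ^ 'n::finite \<Rightarrow> complex) \<Rightarrow> real ^ 'n \<Rightarrow> complex" where
  "partial_deriv i u x = vector_derivative (\<lambda>t. u (x + t *\<^sub>R axis i 1)) (at 0)"

text \<open>Partial derivatives of every order, in every sequence of directions, exist and are
  continuous.\<close>

definition smooth :: "(real ^ 'n::finite \<Rightarrow> complex) \<Rightarrow> bool" where
  "smooth u \<longleftrightarrow>
     (\<forall>is. continuous_on UNIV (foldr partial_deriv is u) \<and>
        (\<forall>i x. (\<lambda>t. foldr partial_deriv is u (x + t *\<^sub>R axis i 1)) differentiable (at 0)))"

text \<open>The derivative for the multi-index \<open>\<alpha>\<close> differentiates \<open>\<alpha> $ i\<close> times in each direction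
  \<open>i\<close>. Some sequence of directions with these multiplicities is chosen; for smooth functions the
  result does not depend on the choice, by the symmetry of mixed derivatives.\<close>

definition multi_deriv ::
    "nat ^ 'n \<Rightarrow> (real ^ 'n::finite \<Rightarrow> complex) \<Rightarrow> real ^ 'n \<Rightarrow> complex" where
  "multi_deriv \<alpha> u = foldr partial_deriv (SOME is. \<forall>i. count_list is i = \<alpha> $ i) u"

definition fourier :: "(real ^ 'n::finite \<Rightarrow> complex) \<Rightarrow> real ^ 'n \<Rightarrow> complex" where
  "fourier u \<xi> = (LINT x|lborel. u x * exp (- \<i> * of_real (x \<bullet> \<xi>)))"


section \<open>Nuclear locally convex spaces over the complex numbers\<close>

text \<open>A vector space is a subset \<open>E\<close> of a type \<open>'a\<close> on which \<open>scl\<close> is a complex scalar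
  multiplication. Seminorms and functionals on \<open>E\<close> are total functions on \<open>'a\<close> whose values
  outside \<open>E\<close> are irrelevant.\<close>

definition seminorm_on ::
    "(complex \<Rightarrow> 'a \<Rightarrow> 'a) \<Rightarrow> 'a set \<Rightarrow> ('a::ab_group_add \<Rightarrow> real) \<Rightarrow> bool" where
  "seminorm_on scl E p \<longleftrightarrow>
     (\<forall>x\<in>E. 0 \<le> p x) \<and>
     (\<forall>x\<in>E. \<forall>y\<in>E. p (x + y) \<le> p x + p y) \<and>
     (\<forall>c. \<forall>x\<in>E. p (scl c x) = cmod c * p x)"

text \<open>The set \<open>E\<close> is listed as an open set only to cover an empty family \<open>P\<close>.\<close>

definition seminorm_topology ::
    "'a set \<Rightarrow> ('a::ab_group_add \<Rightarrow> real) set \<Rightarrow> 'a topology" where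
  "seminorm_topology E P =
     topology_generated_by
       (insert E {{y \<in> E. p (y - x) < r} | p x r. p \<in> P \<and> x \<in> E \<and> 0 < r})"

definition locally_convex_space ::
    "(complex \<Rightarrow> 'a \<Rightarrow> 'a) \<Rightarrow> 'a::ab_group_add topology \<Rightarrow> bool" where
  "locally_convex_space scl X \<longleftrightarrow>
     vector_space scl \<and> module.subspace scl (topspace X) \<and> Hausdorff_space X \<and>
     (\<exists>P. (\<forall>p\<in>P. seminorm_on scl (topspace X) p) \<and> X = seminorm_topology (topspace X) P)"

definition bounded_functional ::
    "(complex \<Rightarrow> 'a \<Rightarrow> 'a) \<Rightarrow> 'a::ab_group_add set \<Rightarrow> ('a \<Rightarrow> real) \<Rightarrow> ('a \<Rightarrow> complex) \<Rightarrow> bool" where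
  "bounded_functional scl E q f \<longleftrightarrow>
     (\<forall>x\<in>E. \<forall>y\<in>E. f (x + y) = f x + f y) \<and>
     (\<forall>c. \<forall>x\<in>E. f (scl c x) = c * f x) \<and>
     (\<exists>C. \<forall>x\<in>E. cmod (f x) \<le> C * q x)"

definition dual_norm :: "'a set \<Rightarrow> ('a \<Rightarrow> real) \<Rightarrow> ('a \<Rightarrow> complex) \<Rightarrow> real" where
  "dual_norm E q f = Sup {cmod (f x) | x. x \<in> E \<and> q x \<le> 1}"

text \<open>The local Banach space \<open>E\<^sub>p\<close> is the completion of \<open>E\<close> modulo the kernel of \<open>p\<close>. Its
  elements are represented by the \<open>p\<close>-Cauchy sequences in \<open>E\<close>, elements of \<open>E\<close> by constant
  sequences; \<open>local_norm p\<close> is the norm of \<open>E\<^sub>p\<close> on representatives.\<close>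

definition local_Cauchy :: "'a::ab_group_add set \<Rightarrow> ('a \<Rightarrow> real) \<Rightarrow> (nat \<Rightarrow> 'a) \<Rightarrow> bool" where
  "local_Cauchy E p y \<longleftrightarrow>
     range y \<subseteq> E \<and> (\<forall>e>0. \<exists>N. \<forall>m\<ge>N. \<forall>n\<ge>N. p (y m - y n) < e)"

definition local_norm :: "('a \<Rightarrow> real) \<Rightarrow> (nat \<Rightarrow> 'a) \<Rightarrow> real" where
  "local_norm p y = lim (\<lambda>k. p (y k))"

text \<open>For \<open>p \<le> q\<close>, the canonical map from \<open>E\<^sub>q\<close> to \<open>E\<^sub>p\<close> is a nuclear operator: it equals
  \<open>\<Sum>n. f n \<otimes> y n\<close> with \<open>f n\<close> in the dual of \<open>E\<^sub>q\<close>, \<open>y n\<close> in \<open>E\<^sub>p\<close> and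
  \<open>(\<Sum>n. \<parallel>f n\<parallel> * \<parallel>y n\<parallel>) < \<infinity>\<close>. The dual of \<open>E\<^sub>q\<close> consists of the \<open>q\<close>-bounded linear
  functionals on \<open>E\<close>, and since both sides are continuous on \<open>E\<^sub>q\<close> they need to be compared only
  on the dense image of \<open>E\<close>.\<close>

definition nuclear_linking_map ::
    "(complex \<Rightarrow> 'a \<Rightarrow> 'a) \<Rightarrow> 'a::ab_group_add set \<Rightarrow> ('a \<Rightarrow> real) \<Rightarrow> ('a \<Rightarrow> real) \<Rightarrow> bool" where
  "nuclear_linking_map scl E q p \<longleftrightarrow>
     (\<exists>(f :: nat \<Rightarrow> 'a \<Rightarrow> complex) (y :: nat \<Rightarrow> nat \<Rightarrow> 'a).
        (\<forall>n. bounded_functional scl E q (f n)) \<and>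
        (\<forall>n. local_Cauchy E p (y n)) \<and>
        summable (\<lambda>n. dual_norm E q (f n) * local_norm p (y n)) \<and>
        (\<forall>x\<in>E. (\<lambda>N. local_norm p (\<lambda>k. x - (\<Sum>n<N. scl (f n x) (y n k)))) \<longlonglongrightarrow> 0))"

definition nuclear_space ::
    "(complex \<Rightarrow> 'a \<Rightarrow> 'a) \<Rightarrow> 'a::ab_group_add topology \<Rightarrow> bool" where
  "nuclear_space scl X \<longleftrightarrow>
     locally_convex_space scl X \<and>
     (\<forall>p. seminorm_on scl (topspace X) p \<and> continuous_map X euclideanreal p \<longrightarrow>
        (\<exists>q. seminorm_on scl (topspace X) q \<and> continuous_map X euclideanreal q \<and>
           (\<forall>x\<in>topspace X. p x \<le> q x) \<and> nuclear_linking_map scl (topspace X) q p))"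


section \<open>The space of rapidly decreasing ultradifferentiable functions\<close>

definition fun_scale :: "complex \<Rightarrow> ('b \<Rightarrow> complex) \<Rightarrow> 'b \<Rightarrow> complex" where
  "fun_scale c u = (\<lambda>x. c * u x)"

definition weighted_sup ::
    "(real \<Rightarrow> real) \<Rightarrow> real \<Rightarrow> nat ^ 'n \<Rightarrow> (real ^ 'n::finite \<Rightarrow> complex) \<Rightarrow> real" where
  "weighted_sup \<omega> r \<alpha> u = (SUP x. exp (r * \<omega> (norm x)) * cmod (multi_deriv \<alpha> u x))"

definition S_space :: "(real \<Rightarrow> real) \<Rightarrow> (real ^ 'n::finite \<Rightarrow> complex) set" where
  "S_space \<omega> =
     {u. integrable lborel u \<and> smooth u \<and> smooth (fourier u) \<and>
        (\<forall>r>0. \<forall>\<alpha>.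
           bdd_above (range (\<lambda>x. exp (r * \<omega> (norm x)) * cmod (multi_deriv \<alpha> u x))) \<and>
           bdd_above (range (\<lambda>\<xi>. exp (r * \<omega> (norm \<xi>)) * cmod (multi_deriv \<alpha> (fourier u) \<xi>))))}"

definition S_seminorms :: "(real \<Rightarrow> real) \<Rightarrow> ((real ^ 'n::finite \<Rightarrow> complex) \<Rightarrow> real) set" where
  "S_seminorms \<omega> =
     {weighted_sup \<omega> r \<alpha> | r \<alpha>. 0 < r} \<union> {\<lambda>u. weighted_sup \<omega> r \<alpha> (fourier u) | r \<alpha>. 0 < r}"

definition S_topology :: "(real \<Rightarrow> real) \<Rightarrow> (real ^ 'n::finite \<Rightarrow> complex) topology" where
  "S_topology \<omega> = seminorm_topology (S_space \<omega>) (S_seminorms \<omega>)"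

end

theory Submission
  imports Defs
begin

text \<open>
The seminorms of \<open>S\<^sub>\<omega>\<close> are weighted suprema of all derivatives of \<open>u\<close> and of its Fourier
transform, which depends linearly on \<open>u\<close>. Nuclearity comes from the fact that a weighted supremum
is dominated by a weighted integral of one more derivative in each coordinate direction.

Indeed, if \<open>w\<close> is smooth and vanishes at infinity with all derivatives, then \<open>w x\<close> is, up to sign,
the integral of \<open>\<partial>\<^sub>1 \<cdots> \<partial>\<^sub>d w\<close> over the orthant with apex \<open>x\<close> that points away from the origin. The
weight \<open>exp (r * \<omega> (norm x))\<close> is increasing in that direction and can be moved under the integral
(\<open>weighted_le_integral_of_mixed_derivative\<close>). Since \<open>\<omega>\<close> grows at least logarithmically, a slightly
larger \<open>r\<close> pays for a polynomial factor, which makes the measure finite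
(\<open>weighted_sup_le_integral\<close>). So each seminorm is bounded by the integral, over a finite measure
space, of the absolute values of weighted point evaluations, and these are functionals bounded by
another seminorm of the family.

It is a general fact that such a locally convex space is nuclear (locale \<open>dominated_functionals\<close>).
Square integrals of the point evaluations define hermitian forms; their norms generate the same
topology. An orthonormal family for a larger form has, at each point evaluation \<open>\<psi>\<close>, a bounded sum
of \<open>\<bar>\<psi> e\<^sub>k\<bar>\<^sup>2\<close>, so that after integration the linking maps between these forms are
Hilbert--Schmidt (\<open>hilbert_schmidt_gram\<close>). A composition of two Hilbert--Schmidt maps is nuclear, with
an explicit representation \<open>x = (\<Sum>n. \<langle>x, e\<^sub>n\<rangle> e\<^sub>n)\<close> (\<open>nuclear_linking_map_via_forms\<close>). The sequence \<open>e\<close>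
is constructed greedily inside the space itself (\<open>greedy_expansion\<close>).
\<close>

section \<open>Hermitian forms on a complex vector space\<close>

lemma mult_cnj_cmod: "z * cnj z = of_real ((cmod z)\<^sup>2)"
  by (simp only: complex_norm_square)

definition form_norm :: "('a \<Rightarrow> 'a \<Rightarrow> complex) \<Rightarrow> 'a \<Rightarrow> real" where
  "form_norm B x = sqrt (Re (B x x))"

locale complex_subspace = vector_space scl
  for scl :: "complex \<Rightarrow> 'a::ab_group_add \<Rightarrow> 'a" +
  fixes E :: "'a set"
  assumes subspace_E: "subspace E"
begin

lemma add_E: "x \<in> E \<Longrightarrow> y \<in> E \<Longrightarrow> x + y \<in> E"
  using subspace_add[OF subspace_E] .

lemma diff_E: "x \<in> E \<Longrightarrow> y \<in> E \<Longrightarrow> x - y \<in> E"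
  using subspace_diff[OF subspace_E] .

lemma scl_E: "x \<in> E \<Longrightarrow> scl c x \<in> E"
  using subspace_scale[OF subspace_E] .

lemma zero_E: "0 \<in> E"
  using subspace_0[OF subspace_E] .

lemma sum_E: "(\<And>i. i \<in> I \<Longrightarrow> f i \<in> E) \<Longrightarrow> sum f I \<in> E"
  using subspace_sum[OF subspace_E] .

lemmas closed_E = add_E diff_E scl_E zero_E sum_E

end

locale hermitian_form = complex_subspace scl E
  for scl :: "complex \<Rightarrow> 'a::ab_group_add \<Rightarrow> 'a" and E +
  fixes B :: "'a \<Rightarrow> 'a \<Rightarrow> complex"
  assumes form_add_left: "x \<in> E \<Longrightarrow> y \<in> E \<Longrightarrow> z \<in> E \<Longrightarrow> B (x + y) z = B x z + B y z"
    and form_scl_left: "x \<in> E \<Longrightarrow> y \<in> E \<Longrightarrow> B (scl c x) y = c * B x y"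
    and form_sym: "x \<in> E \<Longrightarrow> y \<in> E \<Longrightarrow> B y x = cnj (B x y)"
    and form_nonneg: "x \<in> E \<Longrightarrow> 0 \<le> Re (B x x)"
begin

abbreviation nm :: "'a \<Rightarrow> real" where "nm \<equiv> form_norm B"

lemma form_add_right: "x \<in> E \<Longrightarrow> y \<in> E \<Longrightarrow> z \<in> E \<Longrightarrow> B x (y + z) = B x y + B x z"
  using form_sym[of "y + z" x] form_sym[of y x] form_sym[of z x] form_add_left[of y z x] add_E[of y z]
  by simp

lemma form_scl_right: "x \<in> E \<Longrightarrow> y \<in> E \<Longrightarrow> B x (scl c y) = cnj c * B x y"
  using form_sym[of "scl c y" x] form_sym[of y x] form_scl_left[of y x c] scl_E[of y c]
  by simp

lemma form_zero_left: "y \<in> E \<Longrightarrow> B 0 y = 0"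
  using form_scl_left[of y y 0] by simp

lemma form_diff_left: "x \<in> E \<Longrightarrow> y \<in> E \<Longrightarrow> z \<in> E \<Longrightarrow> B (x - y) z = B x z - B y z"
  using form_add_left[of "x - y" y z] diff_E[of x y] by (simp add: algebra_simps)

lemma form_diff_right: "x \<in> E \<Longrightarrow> y \<in> E \<Longrightarrow> z \<in> E \<Longrightarrow> B x (y - z) = B x y - B x z"
  using form_add_right[of x "y - z" z] diff_E[of y z] by (simp add: algebra_simps)

lemma form_sum_left:
  assumes "finite I" "\<And>i. i \<in> I \<Longrightarrow> x i \<in> E" "y \<in> E"
  shows "B (\<Sum>i\<in>I. scl (c i) (x i)) y = (\<Sum>i\<in>I. c i * B (x i) y)"
  using assms
proof (induction I rule: finite_induct)
  case empty
  then show ?case by (simp add: form_zero_left)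
next
  case (insert i I)
  then have "(\<Sum>i\<in>I. scl (c i) (x i)) \<in> E" by (auto intro!: closed_E)
  with insert show ?case by (simp add: form_add_left form_scl_left scl_E)
qed

lemma form_self: "x \<in> E \<Longrightarrow> B x x = of_real ((nm x)\<^sup>2)"
  using form_sym[of x x] form_nonneg[of x] by (auto simp: form_norm_def complex_eq_iff)

lemma nm_nonneg: "x \<in> E \<Longrightarrow> 0 \<le> nm x"
  by (simp add: form_norm_def form_nonneg)

lemma nm_sq: "x \<in> E \<Longrightarrow> (nm x)\<^sup>2 = Re (B x x)"
  by (simp add: form_norm_def form_nonneg)

lemma nm_scl: assumes "x \<in> E" shows "nm (scl c x) = cmod c * nm x"
proof -
  have "B (scl c x) (scl c x) = (c * cnj c) * B x x"
    using assms by (simp add: form_scl_left form_scl_right scl_E)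
  also have "c * cnj c = of_real ((cmod c)\<^sup>2)"
    by (simp add: mult_cnj_cmod)
  finally have "Re (B (scl c x) (scl c x)) = (cmod c)\<^sup>2 * Re (B x x)"
    by simp
  then show ?thesis by (simp add: form_norm_def real_sqrt_mult)
qed

lemma nm_diff_sq:
  assumes "x \<in> E" "y \<in> E"
  shows "(nm (x - y))\<^sup>2 = (nm x)\<^sup>2 - 2 * Re (B x y) + (nm y)\<^sup>2"
  using assms form_sym[of x y] by (simp add: nm_sq diff_E form_diff_left form_diff_right)

lemma Cauchy_Schwarz_form:
  assumes x: "x \<in> E" and y: "y \<in> E"
  shows "cmod (B x y) \<le> nm x * nm y"
proof -
  define b where "b = B x y"
  have key: "0 \<le> (nm x)\<^sup>2 - 2 * t * (cmod b)\<^sup>2 + t\<^sup>2 * (cmod b)\<^sup>2 * (nm y)\<^sup>2" for t :: real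
  proof -
    have "0 \<le> (nm (x - scl (of_real t * b) y))\<^sup>2" by simp
    also have "\<dots> = (nm x)\<^sup>2 - 2 * Re (B x (scl (of_real t * b) y)) + (nm (scl (of_real t * b) y))\<^sup>2"
      using x y by (intro nm_diff_sq scl_E)
    also have "B x (scl (of_real t * b) y) = of_real (t * (cmod b)\<^sup>2)"
      using x y by (simp add: form_scl_right b_def mult_cnj_cmod mult.commute)
    also have "nm (scl (of_real t * b) y) = \<bar>t\<bar> * cmod b * nm y"
      using y by (simp add: nm_scl norm_mult)
    finally show ?thesis by (simp add: power_mult_distrib mult.assoc)
  qed
  have "(cmod b)\<^sup>2 \<le> (nm x * nm y)\<^sup>2"
  proof (cases "nm y = 0")
    case True
    have "b = 0"
    \<comment> \<open>With \<open>nm y = 0\<close> the estimate is affine in \<open>t\<close>, and a large \<open>t\<close> makes it negative.\<close>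
    proof (rule ccontr)
      assume "b \<noteq> 0"
      then show False
        using key[of "((nm x)\<^sup>2 + 1) / (2 * (cmod b)\<^sup>2)"] True by simp
    qed
    then show ?thesis by simp
  next
    case False
    have "(nm x)\<^sup>2 - 2 * (1 / (nm y)\<^sup>2) * (cmod b)\<^sup>2 + (1 / (nm y)\<^sup>2)\<^sup>2 * (cmod b)\<^sup>2 * (nm y)\<^sup>2 =
        (nm x)\<^sup>2 - (cmod b)\<^sup>2 / (nm y)\<^sup>2"
      using False by (simp add: power2_eq_square divide_simps)
    with key[of "1 / (nm y)\<^sup>2"] have "(cmod b)\<^sup>2 / (nm y)\<^sup>2 \<le> (nm x)\<^sup>2" by linarith
    with False show ?thesis by (simp add: field_simps power_mult_distrib)
  qed
  then show ?thesis
    unfolding b_def using nm_nonneg x y by (simp add: abs_le_square_iff flip: abs_le_square_iff)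
qed

lemma nm_triangle:
  assumes x: "x \<in> E" and y: "y \<in> E"
  shows "nm (x + y) \<le> nm x + nm y"
proof (rule power2_le_imp_le)
  have "(nm (x + y))\<^sup>2 = (nm x)\<^sup>2 + 2 * Re (B x y) + (nm y)\<^sup>2"
    using assms form_sym[of x y] by (simp add: nm_sq add_E form_add_left form_add_right)
  also have "Re (B x y) \<le> nm x * nm y"
    using Cauchy_Schwarz_form[OF x y] complex_Re_le_cmod[of "B x y"] by linarith
  finally show "(nm (x + y))\<^sup>2 \<le> (nm x + nm y)\<^sup>2"
    by (simp add: power2_sum)
qed (use nm_nonneg x y in auto)

lemma seminorm_on_nm: "seminorm_on scl E nm"
  by (simp add: seminorm_on_def nm_nonneg nm_triangle nm_scl)

end

section \<open>Hilbert--Schmidt domination of hermitian forms\<close>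

text \<open>Vectors of norm below one are admitted, in particular zero vectors: in a finite-dimensional
space a sequence of pairwise orthogonal vectors has to run into the kernel of the form, and
the families can be extended there without a case distinction.\<close>

definition suborthonormal :: "'a set \<Rightarrow> ('a \<Rightarrow> 'a \<Rightarrow> complex) \<Rightarrow> nat set \<Rightarrow> (nat \<Rightarrow> 'a) \<Rightarrow> bool" where
  "suborthonormal E B I e \<longleftrightarrow>
     (\<forall>i\<in>I. e i \<in> E \<and> form_norm B (e i) \<le> 1) \<and>
     (\<forall>i\<in>I. \<forall>j\<in>I. i \<noteq> j \<longrightarrow> B (e i) (e j) = 0)"

text \<open>The form \<open>A\<close> is dominated by \<open>B\<close> in the Hilbert--Schmidt sense. Testing finite families only
avoids bases of the completions; in the completions, the condition says that the canonical map
from the \<open>B\<close>-space to the \<open>A\<close>-space is a Hilbert--Schmidt operator.\<close>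

definition hilbert_schmidt :: "'a set \<Rightarrow> ('a \<Rightarrow> 'a \<Rightarrow> complex) \<Rightarrow> ('a \<Rightarrow> 'a \<Rightarrow> complex) \<Rightarrow> bool" where
  "hilbert_schmidt E B A \<longleftrightarrow>
     (\<exists>C. \<forall>n e. suborthonormal E B {..<n} e \<longrightarrow> (\<Sum>i<n. (form_norm A (e i))\<^sup>2) \<le> C)"

lemma suborthonormal_mono: "suborthonormal E B I e \<Longrightarrow> J \<subseteq> I \<Longrightarrow> suborthonormal E B J e"
  by (auto simp: suborthonormal_def)

context hermitian_form begin

lemma nm_sum_suborthonormal:
  assumes "finite I" "suborthonormal E B I e"
  shows "(nm (\<Sum>i\<in>I. scl (c i) (e i)))\<^sup>2 = (\<Sum>i\<in>I. (cmod (c i))\<^sup>2 * (nm (e i))\<^sup>2)"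
proof -
  let ?s = "\<Sum>i\<in>I. scl (c i) (e i)"
  have e: "\<And>i. i \<in> I \<Longrightarrow> e i \<in> E" using assms by (simp add: suborthonormal_def)
  then have s: "?s \<in> E" by (auto intro!: closed_E)
  have "B ?s ?s = (\<Sum>i\<in>I. c i * B (e i) ?s)"
    using e s assms(1) by (intro form_sum_left)
  also have "\<dots> = (\<Sum>i\<in>I. of_real ((cmod (c i))\<^sup>2 * (nm (e i))\<^sup>2))"
  proof (rule sum.cong[OF refl])
    fix i assume i: "i \<in> I"
    have "B (e i) ?s = cnj (B ?s (e i))" using e i s form_sym by blast
    also have "B ?s (e i) = (\<Sum>j\<in>I. c j * B (e j) (e i))"
      using e i assms(1) by (intro form_sum_left) auto
    also have "\<dots> = (\<Sum>j\<in>I. if j = i then c i * B (e i) (e i) else 0)"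
      using assms(2) i by (intro sum.cong) (auto simp: suborthonormal_def)
    also have "\<dots> = c i * of_real ((nm (e i))\<^sup>2)"
      using i assms(1) e form_self[of "e i"] by simp
    finally have "B (e i) ?s = cnj (c i) * of_real ((nm (e i))\<^sup>2)" by simp
    then show "c i * B (e i) ?s = of_real ((cmod (c i))\<^sup>2 * (nm (e i))\<^sup>2)"
      using mult_cnj_cmod[of "c i"] by (metis mult.assoc of_real_mult)
  qed
  finally have "Re (B ?s ?s) = (\<Sum>i\<in>I. (cmod (c i))\<^sup>2 * (nm (e i))\<^sup>2)"
    by (simp add: Re_sum)
  then show ?thesis using s by (simp add: nm_sq)
qed

text \<open>Pythagoras for the projection to the span of the family. It is an inequality because the
members of the family may be shorter than one, in which case the sum is not the exact
projection. Bessel's inequality and the contractivity of \<open>x \<mapsto> x - (\<Sum>i. \<langle>x, e\<^sub>i\<rangle> e\<^sub>i)\<close> are both contained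
in it.\<close>

lemma nm_remainder:
  assumes I: "finite I" "suborthonormal E B I e" and x: "x \<in> E"
  shows "(nm (x - (\<Sum>i\<in>I. scl (B x (e i)) (e i))))\<^sup>2 + (\<Sum>i\<in>I. (cmod (B x (e i)))\<^sup>2) \<le> (nm x)\<^sup>2"
proof -
  let ?s = "\<Sum>i\<in>I. scl (B x (e i)) (e i)"
  have e: "\<And>i. i \<in> I \<Longrightarrow> e i \<in> E" "\<And>i. i \<in> I \<Longrightarrow> nm (e i) \<le> 1"
    using assms by (auto simp: suborthonormal_def)
  then have s: "?s \<in> E" by (auto intro!: closed_E)
  have "B ?s x = (\<Sum>i\<in>I. B x (e i) * B (e i) x)"
    using e x assms(1) by (intro form_sum_left)
  also have "\<dots> = (\<Sum>i\<in>I. of_real ((cmod (B x (e i)))\<^sup>2))"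
    using e x form_sym[of x] by (intro sum.cong) (auto simp: mult_cnj_cmod)
  finally have "Re (B x ?s) = (\<Sum>i\<in>I. (cmod (B x (e i)))\<^sup>2)"
    using form_sym[OF s x] by (simp add: Re_sum)
  moreover have "(nm ?s)\<^sup>2 \<le> (\<Sum>i\<in>I. (cmod (B x (e i)))\<^sup>2)"
    unfolding nm_sum_suborthonormal[OF I]
    using e nm_nonneg by (intro sum_mono) (auto simp: power_le_one mult_left_le)
  ultimately show ?thesis using nm_diff_sq[OF x s] by linarith
qed

lemma Bessel:
  assumes "finite I" "suborthonormal E B I e" "x \<in> E"
  shows "(\<Sum>i\<in>I. (cmod (B x (e i)))\<^sup>2) \<le> (nm x)\<^sup>2"
  using nm_remainder[OF assms] zero_le_power2[of "nm (x - (\<Sum>i\<in>I. scl (B x (e i)) (e i)))"] by linarith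

end

text \<open>A single vector is a suborthonormal family. The constant stays uniform on the kernel of \<open>B\<close>
because every multiple of a kernel vector is again such a family.\<close>

lemma hilbert_schmidt_dominated:
  assumes "hermitian_form scl E A" "hermitian_form scl E B" "hilbert_schmidt E B A"
  shows "\<exists>K\<ge>0. \<forall>x\<in>E. form_norm A x \<le> K * form_norm B x"
proof -
  interpret A: hermitian_form scl E A by fact
  interpret B: hermitian_form scl E B by fact
  obtain C where C: "\<And>n e. suborthonormal E B {..<n} e \<Longrightarrow> (\<Sum>i<n. (form_norm A (e i))\<^sup>2) \<le> C"
    using assms(3) by (auto simp: hilbert_schmidt_def)
  have unit: "A.nm x \<le> sqrt C" if "x \<in> E" "B.nm x \<le> 1" for x
  proof -
    have "suborthonormal E B {..<1} (\<lambda>_. x)" using that by (auto simp: suborthonormal_def)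
    from C[OF this] show ?thesis by (simp add: real_le_rsqrt)
  qed
  show ?thesis
  proof (intro exI[of _ "sqrt C"] conjI ballI)
    have "0 \<le> C" using C[of 0 "\<lambda>_. 0"] by (simp add: suborthonormal_def)
    then show "0 \<le> sqrt C" by simp
    fix x assume x: "x \<in> E"
    show "A.nm x \<le> sqrt C * B.nm x"
    proof (cases "B.nm x = 0")
      case True
      have "A.nm x \<le> 0"
      proof (rule ccontr)
        assume "\<not> A.nm x \<le> 0"
        then have pos: "A.nm x > 0" by simp
        define c where "c = (sqrt C + 1) / A.nm x"
        have "c \<ge> 0" using pos \<open>0 \<le> C\<close> by (simp add: c_def)
        have "A.nm (scl (of_real c) x) \<le> sqrt C"
          using x True by (intro unit) (auto simp: B.nm_scl A.scl_E)
        then have "c * A.nm x \<le> sqrt C" using x \<open>c \<ge> 0\<close> by (simp add: A.nm_scl)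
        then show False using pos by (simp add: c_def)
      qed
      then show ?thesis using True by simp
    next
      case False
      then have pos: "B.nm x > 0" using B.nm_nonneg[OF x] by simp
      have "A.nm (scl (of_real (1 / B.nm x)) x) \<le> sqrt C"
        using x pos by (intro unit A.scl_E) (auto simp: B.nm_scl norm_divide)
      then show ?thesis using pos x by (simp add: A.nm_scl norm_divide field_simps)
    qed
  qed
qed

lemma near_maximizer:
  fixes g :: "'a \<Rightarrow> real"
  assumes "S \<noteq> {}" "\<And>x. x \<in> S \<Longrightarrow> 0 \<le> g x" "\<And>x. x \<in> S \<Longrightarrow> g x \<le> K"
  shows "\<exists>r\<in>S. \<forall>x\<in>S. g x \<le> 2 * g r"
proof -
  have bdd: "bdd_above (g ` S)" using assms(3) by (auto intro!: bdd_aboveI2)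
  define s where "s = Sup (g ` S)"
  have le: "g x \<le> s" if "x \<in> S" for x using that bdd by (auto simp: s_def intro: cSUP_upper)
  show ?thesis
  proof (cases "s \<le> 0")
    case True
    then show ?thesis using assms le by (metis ex_in_conv mult_nonneg_nonneg order_trans zero_le_numeral)
  next
    case False
    then have "s / 2 < s" by simp
    then obtain r where "r \<in> S" "s / 2 < g r"
      unfolding s_def using less_cSUP_iff[OF assms(1) bdd] by auto
    then show ?thesis using le by (intro bexI[of _ r] ballI) (force dest: le)+
  qed
qed

text \<open>The sequence is chosen greedily: \<open>e\<^sub>n\<close> is a vector of the \<open>B\<close>-unit ball,
orthogonal to its predecessors, whose \<open>A\<close>-norm is at least half of the supremum. The
Hilbert--Schmidt bound forces the \<open>A\<close>-norm of \<open>e\<^sub>n\<close> to tend to zero, and the \<open>N\<close>-th remainder of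
\<open>x\<close> competes with \<open>e\<^sub>N\<close>, so its \<open>A\<close>-norm is at most a constant times that of \<open>e\<^sub>N\<close>.\<close>

lemma greedy_expansion:
  assumes hA: "hermitian_form scl E A" and hB: "hermitian_form scl E B" and hs: "hilbert_schmidt E B A"
  shows "\<exists>e. suborthonormal E B UNIV e \<and> summable (\<lambda>n. (form_norm A (e n))\<^sup>2) \<and>
    (\<forall>x\<in>E. (\<lambda>N. form_norm A (x - (\<Sum>n<N. scl (B x (e n)) (e n)))) \<longlonglongrightarrow> 0)"
proof -
  interpret A: hermitian_form scl E A by fact
  interpret B: hermitian_form scl E B by fact
  obtain K where K: "K \<ge> 0" "\<And>x. x \<in> E \<Longrightarrow> A.nm x \<le> K * B.nm x"
    using hilbert_schmidt_dominated[OF assms] by blast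
  \<comment> \<open>The competitors in step \<open>m\<close>, after the choice of \<open>f 0, \<dots>, f (m - 1)\<close>.\<close>
  define S where "S f m = {x \<in> E. B.nm x \<le> 1 \<and> (\<forall>i<m. B x (f i) = 0)}" for f :: "nat \<Rightarrow> 'a" and m
  define good where "good f m r \<longleftrightarrow>
     r \<in> S f m \<and> (B.nm r = 0 \<or> B.nm r = 1) \<and> (\<forall>x\<in>S f m. A.nm x \<le> 2 * A.nm r)" for f m r
  have "\<exists>e. \<forall>m. good e m (e m)"
  proof (rule dependent_wellorder_choice)
    fix r and f g :: "nat \<Rightarrow> 'a" and m assume "\<And>y. y < m \<Longrightarrow> f y = g y"
    then have "S f m = S g m" by (auto simp: S_def)
    then show "good f m r = good g m r" by (simp add: good_def)
  next
    fix m f assume prev: "\<And>y. y < m \<Longrightarrow> good f y (f y)"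
    have "\<exists>r\<in>S f m. \<forall>x\<in>S f m. A.nm x \<le> 2 * A.nm r"
    proof (rule near_maximizer[where K = K])
      have "0 \<in> S f m" using A.zero_E prev
        by (auto simp: S_def good_def form_norm_def B.form_zero_left)
      then show "S f m \<noteq> {}" by auto
    next
      fix x assume x: "x \<in> S f m"
      then have "A.nm x \<le> K * B.nm x" "B.nm x \<le> 1" using K(2) by (auto simp: S_def)
      then show "A.nm x \<le> K" using K(1) by (meson mult_left_le order_trans)
    qed (auto simp: S_def A.nm_nonneg)
    then obtain r where r: "r \<in> S f m" "\<forall>x\<in>S f m. A.nm x \<le> 2 * A.nm r" by blast
    then have rE: "r \<in> E" "B.nm r \<le> 1" by (auto simp: S_def)
    \<comment> \<open>Length exactly zero or one makes the later remainders orthogonal to the chosen vectors.\<close>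
    show "\<exists>r. good f m r"
    proof (cases "B.nm r = 0")
      case True
      then show ?thesis using r by (auto simp: good_def)
    next
      case False
      then have pos: "B.nm r > 0" using B.nm_nonneg[OF rE(1)] by simp
      define r' where "r' = scl (of_real (1 / B.nm r)) r"
      have "B.nm r' = 1" using pos rE by (simp add: r'_def B.nm_scl norm_divide)
      moreover have "A.nm r \<le> A.nm r'"
        using pos rE A.nm_nonneg[OF rE(1)] by (simp add: r'_def A.nm_scl norm_divide field_simps mult_left_le)
      moreover have "B r' (f i) = 0" if "i < m" for i
      proof -
        have "f i \<in> E" using prev[OF that] by (auto simp: good_def S_def)
        then show ?thesis using r(1) rE that by (auto simp: r'_def S_def B.form_scl_left)
      qed
      moreover have "r' \<in> E" using rE by (simp add: r'_def A.scl_E)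
      ultimately have "good f m r'" using r by (force simp: good_def S_def)
      then show ?thesis ..
    qed
  qed
  then obtain e where e: "\<And>m. good e m (e m)" by blast
  have eE: "e m \<in> E" and e1: "B.nm (e m) = 0 \<or> B.nm (e m) = 1" and e_le: "B.nm (e m) \<le> 1"
    and emax: "\<And>x. x \<in> S e m \<Longrightarrow> A.nm x \<le> 2 * A.nm (e m)" for m
    using e[of m] by (auto simp: good_def S_def)
  have ortho1: "B (e m) (e i) = 0" if "i < m" for i m
    using e[of m] that by (auto simp: good_def S_def)
  then have ortho: "B (e i) (e j) = 0" if "i \<noteq> j" for i j
    using that B.form_sym[OF eE eE, of i j] by (metis complex_cnj_zero linorder_neqE_nat)
  then have so: "suborthonormal E B UNIV e" using eE e_le by (simp add: suborthonormal_def)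
  obtain C where C: "\<And>n e. suborthonormal E B {..<n} e \<Longrightarrow> (\<Sum>i<n. (form_norm A (e i))\<^sup>2) \<le> C"
    using hs by (auto simp: hilbert_schmidt_def)
  have sm: "summable (\<lambda>n. (A.nm (e n))\<^sup>2)"
    using C suborthonormal_mono[OF so] by (intro summableI_nonneg_bounded[where x = C]) auto
  then have "(\<lambda>n. sqrt ((A.nm (e n))\<^sup>2)) \<longlonglongrightarrow> sqrt 0"
    by (intro tendsto_real_sqrt summable_LIMSEQ_zero)
  then have lim: "(\<lambda>n. A.nm (e n)) \<longlonglongrightarrow> 0" using A.nm_nonneg[OF eE] by simp
  have "(\<lambda>N. A.nm (x - (\<Sum>n<N. scl (B x (e n)) (e n)))) \<longlonglongrightarrow> 0" if x: "x \<in> E" for x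
  proof -
    define z where "z N = x - (\<Sum>n<N. scl (B x (e n)) (e n))" for N
    have zE: "z N \<in> E" for N using x eE by (auto simp: z_def intro!: A.closed_E)
    have zle: "B.nm (z N) \<le> B.nm x" for N
    proof (rule power2_le_imp_le)
      have "0 \<le> (\<Sum>i<N. (cmod (B x (e i)))\<^sup>2)" by (intro sum_nonneg) auto
      then show "(B.nm (z N))\<^sup>2 \<le> (B.nm x)\<^sup>2"
        using B.nm_remainder[OF _ suborthonormal_mono[OF so, of "{..<N}"] x] by (simp add: z_def)
    qed (simp add: B.nm_nonneg x)
    have zo: "B (z N) (e j) = 0" if "j < N" for j N
    proof -
      have "B (z N) (e j) = B x (e j) - (\<Sum>n<N. B x (e n) * B (e n) (e j))"
        unfolding z_def using x eE
        by (subst B.form_diff_left) (auto intro!: A.closed_E simp: B.form_sum_left)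
      also have "(\<Sum>n<N. B x (e n) * B (e n) (e j)) = (\<Sum>n<N. if n = j then B x (e j) * B (e j) (e j) else 0)"
        by (intro sum.cong) (auto simp: ortho)
      also have "\<dots> = B x (e j) * of_real ((B.nm (e j))\<^sup>2)"
        using that B.form_self[OF eE, of j] by simp
      also have "B x (e j) - \<dots> = 0"
        using e1[of j] B.Cauchy_Schwarz_form[OF x eE, of j] by auto
      finally show ?thesis .
    qed
    define c where "c = B.nm x + 1"
    have c: "c > 0" using B.nm_nonneg[OF x] by (simp add: c_def)
    have bound: "A.nm (z N) \<le> c * (2 * A.nm (e N))" for N
    proof -
      have "B.nm (scl (of_real (1/c)) (z N)) = B.nm (z N) / c"
        using c zE by (simp add: B.nm_scl norm_divide)
      also have "\<dots> \<le> 1" using zle[of N] c by (simp add: c_def)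
      finally have "scl (of_real (1/c)) (z N) \<in> S e N"
        using zE eE zo by (auto simp: S_def B.form_scl_left intro!: A.scl_E)
      from emax[OF this] show ?thesis
        using c zE by (simp add: A.nm_scl norm_divide field_simps)
    qed
    have "(\<lambda>N. c * (2 * A.nm (e N))) \<longlonglongrightarrow> c * (2 * 0)"
      by (intro tendsto_intros lim)
    then have lim0: "(\<lambda>N. c * (2 * A.nm (e N))) \<longlonglongrightarrow> 0" by simp
    have "(\<lambda>N. A.nm (z N)) \<longlonglongrightarrow> 0"
      by (rule tendsto_sandwich[OF _ _ tendsto_const lim0]) (auto intro!: always_eventually A.nm_nonneg zE bound)
    then show ?thesis by (simp add: z_def)
  qed
  then show ?thesis using so sm by blast
qed

text \<open>A composition of two Hilbert--Schmidt maps is nuclear. The expansion along the greedy sequence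
\<open>e\<close> for \<open>B\<close> over \<open>A\<close> represents the linking map with functionals \<open>\<langle>\<cdot>, e\<^sub>n\<rangle>\<close> and vectors \<open>e\<^sub>n\<close>. The
\<open>A\<close>-norms of the vectors are square summable. So are the \<open>D\<close>-dual norms of the functionals:
expanding along the greedy sequence \<open>g\<close> for \<open>D\<close> over \<open>B\<close> bounds the \<open>n\<close>-th one by \<open>\<beta> n\<close>, where
\<open>(\<beta> n)\<^sup>2 = (\<Sum>k. \<bar>\<langle>g\<^sub>k, e\<^sub>n\<rangle>\<bar>\<^sup>2)\<close>, and Bessel's inequality bounds the sum of this over \<open>n\<close> by
the sum of the squared \<open>B\<close>-norms of the \<open>g\<^sub>k\<close>. The product of the two sequences is summable.\<close>

lemma nuclear_linking_map_via_forms: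
  assumes hA: "hermitian_form scl E A" and hB: "hermitian_form scl E B" and hD: "hermitian_form scl E D"
    and BA: "hilbert_schmidt E B A" and DB: "hilbert_schmidt E D B"
    and p: "seminorm_on scl E p" "\<And>x. x \<in> E \<Longrightarrow> p x \<le> K * form_norm A x" and K: "K \<ge> 0"
    and q: "seminorm_on scl E q" "\<And>x. x \<in> E \<Longrightarrow> form_norm D x \<le> q x"
  shows "nuclear_linking_map scl E q p"
proof -
  interpret A: hermitian_form scl E A by fact
  interpret B: hermitian_form scl E B by fact
  interpret D: hermitian_form scl E D by fact
  obtain e where e: "suborthonormal E B UNIV e" "summable (\<lambda>n. (A.nm (e n))\<^sup>2)"
     "\<And>x. x \<in> E \<Longrightarrow> (\<lambda>N. A.nm (x - (\<Sum>n<N. scl (B x (e n)) (e n)))) \<longlonglongrightarrow> 0"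
    using greedy_expansion[OF hA hB BA] by blast
  obtain g where g: "suborthonormal E D UNIV g" "summable (\<lambda>n. (B.nm (g n))\<^sup>2)"
     "\<And>x. x \<in> E \<Longrightarrow> (\<lambda>N. B.nm (x - (\<Sum>n<N. scl (D x (g n)) (g n)))) \<longlonglongrightarrow> 0"
    using greedy_expansion[OF hB hD DB] by blast
  have eE: "e n \<in> E" and e1: "B.nm (e n) \<le> 1" for n using e by (auto simp: suborthonormal_def)
  have gE: "g n \<in> E" for n using g by (auto simp: suborthonormal_def)
  have CS1: "cmod (B x (e n)) \<le> B.nm x" if "x \<in> E" for x n
    using B.Cauchy_Schwarz_form[OF that eE, of n] e1[of n] B.nm_nonneg[OF that]
    by (meson mult_left_le order_trans)
  define \<beta> where "\<beta> n = sqrt (\<Sum>k. (cmod (B (g k) (e n)))\<^sup>2)" for n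
  have smk: "summable (\<lambda>k. (cmod (B (g k) (e n)))\<^sup>2)" for n
    using g(2) by (rule summable_comparison_test') (auto intro!: power_mono CS1 gE)
  have \<beta>0: "\<beta> n \<ge> 0" for n by (auto simp: \<beta>_def intro!: suminf_nonneg smk)
  have f_le: "cmod (B x (e n)) \<le> \<beta> n * D.nm x" if x: "x \<in> E" for x n
  proof -
    define s where "s m = (\<Sum>k<m. scl (D x (g k)) (g k))" for m
    have sE: "s m \<in> E" for m by (auto simp: s_def intro!: gE A.closed_E)
    have sle: "cmod (B (s m) (e n)) \<le> \<beta> n * D.nm x" for m
    proof -
      have "B (s m) (e n) = (\<Sum>k<m. D x (g k) * B (g k) (e n))"
        by (simp add: s_def B.form_sum_left gE eE)
      also have "cmod \<dots> \<le> (\<Sum>k<m. \<bar>cmod (D x (g k))\<bar> * \<bar>cmod (B (g k) (e n))\<bar>)"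
        by (rule order_trans[OF norm_sum]) (simp add: norm_mult)
      also have "\<dots> \<le> L2_set (\<lambda>k. cmod (D x (g k))) {..<m} * L2_set (\<lambda>k. cmod (B (g k) (e n))) {..<m}"
        by (rule L2_set_mult_ineq)
      also have "\<dots> \<le> D.nm x * \<beta> n"
      proof (intro mult_mono)
        show "L2_set (\<lambda>k. cmod (D x (g k))) {..<m} \<le> D.nm x"
          unfolding L2_set_def
          using D.Bessel[OF _ suborthonormal_mono[OF g(1)] x, of "{..<m}"] D.nm_nonneg[OF x]
          by (simp add: real_le_lsqrt)
        show "L2_set (\<lambda>k. cmod (B (g k) (e n))) {..<m} \<le> \<beta> n"
          unfolding L2_set_def \<beta>_def by (intro real_sqrt_le_mono sum_le_suminf smk) auto
      qed (auto simp: D.nm_nonneg[OF x])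
      finally show ?thesis by (simp add: mult.commute)
    qed
    have "cmod (B x (e n)) \<le> \<beta> n * D.nm x + B.nm (x - s m)" for m
    proof -
      have "B x (e n) = B (s m) (e n) + B (x - s m) (e n)"
        using x sE eE by (simp add: B.form_diff_left)
      then have "cmod (B x (e n)) \<le> cmod (B (s m) (e n)) + cmod (B (x - s m) (e n))"
        by (simp add: norm_triangle_ineq)
      with sle[of m] CS1[OF A.diff_E[OF x sE], of m n] show ?thesis by linarith
    qed
    moreover have "(\<lambda>m. \<beta> n * D.nm x + B.nm (x - s m)) \<longlonglongrightarrow> \<beta> n * D.nm x + 0"
      unfolding s_def by (intro tendsto_intros g(3) x)
    ultimately show ?thesis using LIMSEQ_le_const by fastforce
  qed
  have sm\<beta>: "summable (\<lambda>n. (\<beta> n)\<^sup>2)"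
  proof (rule summableI_nonneg_bounded)
    fix N
    have "(\<Sum>n<N. (\<beta> n)\<^sup>2) = (\<Sum>n<N. \<Sum>k. (cmod (B (g k) (e n)))\<^sup>2)"
      unfolding \<beta>_def by (intro sum.cong) (auto intro!: real_sqrt_pow2 suminf_nonneg smk)
    also have "\<dots> = (\<Sum>k. \<Sum>n<N. (cmod (B (g k) (e n)))\<^sup>2)"
      by (rule suminf_sum[symmetric]) (rule smk)
    also have "\<dots> \<le> (\<Sum>k. (B.nm (g k))\<^sup>2)"
      by (intro suminf_le B.Bessel gE suborthonormal_mono[OF e(1)] g(2) summable_sum smk) auto
    finally show "(\<Sum>n<N. (\<beta> n)\<^sup>2) \<le> (\<Sum>k. (B.nm (g k))\<^sup>2)" .
  qed auto
  have p0: "0 \<le> p x" if "x \<in> E" for x using p(1) that by (simp add: seminorm_on_def)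
  have pz: "p 0 = 0"
    using p(1) A.zero_E unfolding seminorm_on_def by (metis A.scale_zero_left mult_zero_left norm_zero)
  have dual_set: "r \<le> \<beta> n" if r: "r \<in> {cmod (B x (e n)) | x. x \<in> E \<and> q x \<le> 1}" for r n
  proof -
    obtain x where x: "r = cmod (B x (e n))" "x \<in> E" "q x \<le> 1" using r by blast
    then have "D.nm x \<le> 1" using q(2) by force
    then show ?thesis using x f_le[OF x(2), of n] \<beta>0[of n] by (meson mult_left_le order_trans)
  qed
  have "q 0 = 0"
    using q(1) A.zero_E unfolding seminorm_on_def by (metis A.scale_zero_left mult_zero_left norm_zero)
  then have zero_mem: "0 \<in> {cmod (B x (e n)) |x. x \<in> E \<and> q x \<le> 1}" for n
    using A.zero_E B.form_zero_left[OF eE, of n] by (intro CollectI exI[of _ 0]) auto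
  show ?thesis
    unfolding nuclear_linking_map_def
  proof (intro exI[of _ "\<lambda>n x. B x (e n)"] exI[of _ "\<lambda>n k. e n"] conjI allI ballI)
    fix n
    show "bounded_functional scl E q (\<lambda>x. B x (e n))"
      unfolding bounded_functional_def
    proof (intro conjI ballI allI exI[of _ "\<beta> n"])
      fix x assume x: "x \<in> E"
      show "cmod (B x (e n)) \<le> \<beta> n * q x"
        using f_le[OF x, of n] mult_left_mono[OF q(2)[OF x] \<beta>0[of n]] by linarith
    qed (auto simp: B.form_add_left B.form_scl_left eE)
    show "local_Cauchy E p (\<lambda>k. e n)"
      using eE pz by (auto simp: local_Cauchy_def)
  next
    have ln: "local_norm p (\<lambda>k. y) = p y" for y
      by (simp add: local_norm_def)
    show "summable (\<lambda>n. dual_norm E q (\<lambda>x. B x (e n)) * local_norm p (\<lambda>k. e n))"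
    proof (rule summable_comparison_test')
      show "summable (\<lambda>n. K * ((\<beta> n)\<^sup>2 + (A.nm (e n))\<^sup>2))"
        by (intro summable_mult summable_add sm\<beta> e(2))
    next
      fix n :: nat
      have pe: "0 \<le> p (e n)" "p (e n) \<le> K * A.nm (e n)" using p0 p(2) eE by auto
      have "dual_norm E q (\<lambda>x. B x (e n)) \<le> \<beta> n"
        unfolding dual_norm_def using zero_mem[of n] dual_set by (intro cSup_least) auto
      moreover have "0 \<le> dual_norm E q (\<lambda>x. B x (e n))"
        unfolding dual_norm_def
        using zero_mem[of n] dual_set[of _ n] by (intro cSup_upper bdd_aboveI[where M = "\<beta> n"])
      ultimately have "\<bar>dual_norm E q (\<lambda>x. B x (e n))\<bar> \<le> \<beta> n" by simp
      then have "norm (dual_norm E q (\<lambda>x. B x (e n)) * p (e n)) \<le> \<beta> n * (K * A.nm (e n))"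
        using pe \<beta>0[of n] by (auto simp: abs_mult intro!: mult_mono)
      also have "\<dots> = K * (\<beta> n * A.nm (e n))" by simp
      also have "\<dots> \<le> K * ((\<beta> n)\<^sup>2 + (A.nm (e n))\<^sup>2)"
      proof (rule mult_left_mono[OF _ K])
        have "0 \<le> \<beta> n * A.nm (e n)" using \<beta>0 A.nm_nonneg[OF eE] by simp
        then show "\<beta> n * A.nm (e n) \<le> (\<beta> n)\<^sup>2 + (A.nm (e n))\<^sup>2"
          using sum_squares_bound[of "\<beta> n" "A.nm (e n)"] by linarith
      qed
      finally show "norm (dual_norm E q (\<lambda>x. B x (e n)) * local_norm p (\<lambda>k. e n))
         \<le> K * ((\<beta> n)\<^sup>2 + (A.nm (e n))\<^sup>2)" by (simp add: ln)
    qed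
    fix x assume x: "x \<in> E"
    have zE: "x - (\<Sum>n<N. scl (B x (e n)) (e n)) \<in> E" for N
      using x eE by (auto intro!: A.closed_E)
    have "(\<lambda>N. K * A.nm (x - (\<Sum>n<N. scl (B x (e n)) (e n)))) \<longlonglongrightarrow> K * 0"
      by (intro tendsto_intros e(3) x)
    then have lim0: "(\<lambda>N. K * A.nm (x - (\<Sum>n<N. scl (B x (e n)) (e n)))) \<longlonglongrightarrow> 0" by simp
    have "(\<lambda>N. p (x - (\<Sum>n<N. scl (B x (e n)) (e n)))) \<longlonglongrightarrow> 0"
      by (rule tendsto_sandwich[OF _ _ tendsto_const lim0]) (auto intro!: always_eventually p0 p(2) zE)
    then show "(\<lambda>N. local_norm p (\<lambda>k. x - (\<Sum>n<N. scl (B x (e n)) (e n)))) \<longlonglongrightarrow> 0"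
      by (simp add: ln)
  qed
qed

section \<open>Topologies generated by seminorms\<close>

lemma topspace_seminorm_topology [simp]: "topspace (seminorm_topology E P) = E"
  by (auto simp: seminorm_topology_def)

lemma openin_seminorm_ball:
  "p \<in> P \<Longrightarrow> x \<in> E \<Longrightarrow> 0 < r \<Longrightarrow> openin (seminorm_topology E P) {y \<in> E. p (y - x) < r}"
  unfolding seminorm_topology_def by (rule topology_generated_by_Basis) blast

context complex_subspace begin

lemma seminorm_on_diff_commute:
  assumes "seminorm_on scl E p" "x \<in> E" "y \<in> E"
  shows "p (x - y) = p (y - x)"
proof -
  have "x - y = scl (-1) (y - x)" by simp
  moreover have "p (scl (-1) (y - x)) = cmod (-1) * p (y - x)"
    using assms by (simp only: seminorm_on_def diff_E)
  ultimately show ?thesis by simp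
qed

lemma seminorm_on_zero: "seminorm_on scl E p \<Longrightarrow> p 0 = 0"
  using zero_E unfolding seminorm_on_def by (metis scale_zero_left mult_zero_left norm_zero)

lemma seminorm_on_scale:
  "seminorm_on scl E p \<Longrightarrow> 0 \<le> c \<Longrightarrow> seminorm_on scl E (\<lambda>x. c * p x)"
  by (simp add: seminorm_on_def mult_left_mono flip: distrib_left)

text \<open>Balls around arbitrary centres generate the topology; the triangle inequality moves the
centres to the point under consideration.\<close>

lemma generated_neighbourhood:
  assumes P: "\<And>p. p \<in> P \<Longrightarrow> seminorm_on scl E p"
    and "openin (seminorm_topology E P) U" "x \<in> U"
  shows "\<exists>F \<epsilon>. finite F \<and> F \<subseteq> P \<and> 0 < \<epsilon> \<and> (\<forall>y\<in>E. (\<forall>p\<in>F. p (y - x) < \<epsilon>) \<longrightarrow> y \<in> U)"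
proof -
  have "generate_topology_on (insert E {{y \<in> E. p (y - x) < r} | p x r. p \<in> P \<and> x \<in> E \<and> 0 < r}) U"
    using assms(2) by (simp add: seminorm_topology_def openin_topology_generated_by_iff)
  then show ?thesis using assms(3)
  proof (induction arbitrary: x rule: generate_topology_on.induct)
    case Empty
    then show ?case by simp
  next
    case (Int U V)
    then have x: "x \<in> U" "x \<in> V" by auto
    obtain F \<epsilon> where F: "finite F" "F \<subseteq> P" "0 < \<epsilon>" "\<forall>y\<in>E. (\<forall>p\<in>F. p (y - x) < \<epsilon>) \<longrightarrow> y \<in> U"
      using Int.IH(1)[OF x(1)] by blast
    obtain F' \<epsilon>' where F': "finite F'" "F' \<subseteq> P" "0 < \<epsilon>'" "\<forall>y\<in>E. (\<forall>p\<in>F'. p (y - x) < \<epsilon>') \<longrightarrow> y \<in> V"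
      using Int.IH(2)[OF x(2)] by blast
    show ?case using F F' by (intro exI[of _ "F \<union> F'"] exI[of _ "min \<epsilon> \<epsilon>'"]) auto
  next
    case (UN K)
    then obtain k where "k \<in> K" "x \<in> k" by blast
    with UN.IH[of k x] show ?case by (metis UnionI)
  next
    case (Basis S)
    show ?case
    proof (cases "S = E")
      case True
      then show ?thesis by (intro exI[of _ "{}"] exI[of _ 1]) auto
    next
      case False
      with Basis obtain p z r where S: "S = {y \<in> E. p (y - z) < r}" "p \<in> P" "z \<in> E" "0 < r" by blast
      with Basis have x: "x \<in> E" "p (x - z) < r" by auto
      have "y \<in> S" if "y \<in> E" "p (y - x) < r - p (x - z)" for y
      proof -
        have "p ((y - x) + (x - z)) \<le> p (y - x) + p (x - z)"
          using P[OF S(2)] that x S(3) diff_E unfolding seminorm_on_def by blast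
        then show ?thesis using that S(1) by simp
      qed
      then show ?thesis using S(2) x
        by (intro exI[of _ "{p}"] exI[of _ "r - p (x - z)"]) auto
    qed
  qed
qed

text \<open>The unit ball of a continuous seminorm contains a basic neighbourhood of zero, and scaling
turns this into an inequality of seminorms.\<close>

lemma continuous_seminorm_dominated:
  assumes P: "\<And>i. i \<in> I \<Longrightarrow> seminorm_on scl E (P i)"
    and p: "seminorm_on scl E p" "continuous_map (seminorm_topology E (P ` I)) euclideanreal p"
  shows "\<exists>F K. finite F \<and> F \<subseteq> I \<and> 0 \<le> K \<and> (\<forall>x\<in>E. p x \<le> K * (\<Sum>i\<in>F. P i x))"
proof -
  let ?X = "seminorm_topology E (P ` I)"
  have "openin ?X {x \<in> topspace ?X. p x \<in> {..<1}}"
    by (rule openin_continuous_map_preimage[OF p(2)]) auto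
  then have "openin ?X {x \<in> E. p x < 1}" by simp
  moreover have "0 \<in> {x \<in> E. p x < 1}" using zero_E seminorm_on_zero[OF p(1)] by simp
  ultimately obtain F' \<epsilon> where F': "finite F'" "F' \<subseteq> P ` I" "0 < \<epsilon>"
    and sub: "\<And>y. y \<in> E \<Longrightarrow> (\<forall>p\<in>F'. p (y - 0) < \<epsilon>) \<Longrightarrow> y \<in> {x \<in> E. p x < 1}"
    using generated_neighbourhood[of "P ` I" "{x \<in> E. p x < 1}" 0] P by blast
  obtain F where F: "F \<subseteq> I" "finite F" "F' = P ` F"
    using finite_subset_image[OF F'(1,2)] by blast
  have "p x \<le> (2 / \<epsilon>) * (\<Sum>i\<in>F. P i x)" if x: "x \<in> E" for x
  proof (rule field_le_epsilon)
    fix d :: real assume d: "d > 0"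
    \<comment> \<open>The extra summand keeps the scaling factor finite when all \<open>P i x\<close> vanish.\<close>
    define s where "s = (\<Sum>i\<in>F. P i x) + \<epsilon> * d / 2"
    have Pn: "0 \<le> P i x" if "i \<in> F" for i using P that F(1) x by (auto simp: seminorm_on_def)
    have s: "s > 0" unfolding s_def using F'(3) d Pn by (intro add_nonneg_pos sum_nonneg) auto
    define c where "c = \<epsilon> / (2 * s)"
    have c: "c > 0" using s F'(3) by (simp add: c_def)
    have "P i (scl (of_real c) x) < \<epsilon>" if i: "i \<in> F" for i
    proof -
      have "P i x \<le> (\<Sum>i\<in>F. P i x)" using i F(2) Pn by (intro member_le_sum) auto
      also have "\<dots> \<le> s" using d F'(3) by (simp add: s_def)
      finally have "c * P i x \<le> c * s" using c by (intro mult_left_mono) auto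
      moreover have "c * s = \<epsilon> / 2" using s by (simp add: c_def)
      moreover have "P i (scl (of_real c) x) = c * P i x"
        using P i F(1) x c by (auto simp: seminorm_on_def)
      ultimately show ?thesis using F'(3) by linarith
    qed
    then have "p (scl (of_real c) x) < 1"
      using sub[of "scl (of_real c) x"] x F(3) by (simp add: scl_E)
    then have "c * p x < 1" using p(1) x c by (auto simp: seminorm_on_def)
    then have "p x < 1 / c" using c by (simp add: field_simps)
    also have "1 / c = (2 / \<epsilon>) * (\<Sum>i\<in>F. P i x) + d" using s F'(3) by (simp add: c_def s_def field_simps)
    finally show "p x \<le> (2 / \<epsilon>) * (\<Sum>i\<in>F. P i x) + d" by simp
  qed
  then show ?thesis using F F'(3) by (intro exI[of _ F] exI[of _ "2 / \<epsilon>"]) auto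
qed

lemma continuous_seminormI:
  assumes P: "\<And>i. i \<in> I \<Longrightarrow> seminorm_on scl E (P i)"
    and q: "seminorm_on scl E q" and F: "finite F" "F \<subseteq> I"
    and le: "\<And>x. x \<in> E \<Longrightarrow> q x \<le> K * (\<Sum>i\<in>F. P i x)" and K: "0 \<le> K"
  shows "continuous_map (seminorm_topology E (P ` I)) euclideanreal q"
proof -
  let ?X = "seminorm_topology E (P ` I)"
  have "openin ?X {x \<in> E. q x \<in> U}" if U: "open U" for U
  proof (subst openin_subopen, intro ballI)
    fix x assume "x \<in> {x \<in> E. q x \<in> U}"
    then have x: "x \<in> E" "q x \<in> U" by auto
    obtain e where e: "e > 0" "ball (q x) e \<subseteq> U" using U x(2) openE by blast
    define \<delta> where "\<delta> = e / (K * card F + 1)"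
    have den: "K * card F + 1 > 0" using K by (intro add_nonneg_pos) auto
    then have \<delta>: "\<delta> > 0" using e by (simp add: \<delta>_def)
    define T where "T = (\<Inter>i\<in>F. {y \<in> E. P i (y - x) < \<delta>}) \<inter> topspace ?X"
    have "openin ?X T"
      unfolding T_def using F \<delta> x(1) by (intro openin_INT openin_seminorm_ball ballI) auto
    moreover have "x \<in> T"
      using x(1) \<delta> F(2) seminorm_on_zero[OF P] by (auto simp: T_def)
    moreover have "T \<subseteq> {x \<in> E. q x \<in> U}"
    proof
      fix y assume y: "y \<in> T"
      then have yE: "y \<in> E" by (simp add: T_def)
      have "q (y - x) \<le> K * (\<Sum>i\<in>F. P i (y - x))" by (rule le[OF diff_E[OF yE x(1)]])
      also have "\<dots> \<le> K * (\<Sum>i\<in>F. \<delta>)"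
        using y K by (intro mult_left_mono sum_mono) (auto simp: T_def less_imp_le)
      also have "\<dots> = K * card F * \<delta>" by simp
      also have "\<dots> < (K * card F + 1) * \<delta>" using \<delta> by (simp add: algebra_simps)
      also have "\<dots> = e" using den by (simp add: \<delta>_def)
      finally have small: "q (y - x) < e" .
      have "q y \<le> q (y - x) + q x" "q x \<le> q (x - y) + q y"
        using q x(1) yE diff_E unfolding seminorm_on_def
        by (metis diff_add_cancel)+
      then have "\<bar>q x - q y\<bar> < e"
        using small seminorm_on_diff_commute[OF q x(1) yE] by linarith
      then show "y \<in> {x \<in> E. q x \<in> U}" using e(2) yE by (auto simp: ball_def dist_real_def)
    qed
    ultimately show "\<exists>T. openin ?X T \<and> x \<in> T \<and> T \<subseteq> {x \<in> E. q x \<in> U}" by blast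
  qed
  then show ?thesis by (auto simp: continuous_map)
qed

lemma locally_convex_space_seminorm_topology:
  assumes P: "\<And>p. p \<in> P \<Longrightarrow> seminorm_on scl E p"
    and sep: "\<And>x. x \<in> E \<Longrightarrow> (\<And>p. p \<in> P \<Longrightarrow> p x = 0) \<Longrightarrow> x = 0"
  shows "locally_convex_space scl (seminorm_topology E P)"
proof -
  have "Hausdorff_space (seminorm_topology E P)"
    unfolding Hausdorff_space_def topspace_seminorm_topology
  proof (intro allI impI)
    fix x y assume "x \<in> E \<and> y \<in> E \<and> x \<noteq> y"
    then have xy: "x \<in> E" "y \<in> E" "x - y \<noteq> 0" by auto
    then obtain p where p: "p \<in> P" "p (x - y) \<noteq> 0" using sep diff_E by blast
    define r where "r = p (x - y)"
    have r: "r > 0" using p P[OF p(1)] diff_E[OF xy(1,2)] by (force simp: r_def seminorm_on_def)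
    have "\<not> (p (z - x) < r / 2 \<and> p (z - y) < r / 2)" if z: "z \<in> E" for z
    proof -
      have "p ((x - z) + (z - y)) \<le> p (x - z) + p (z - y)"
        using P[OF p(1)] xy z diff_E unfolding seminorm_on_def by blast
      then show ?thesis
        using seminorm_on_diff_commute[OF P[OF p(1)] xy(1) z] by (simp add: r_def)
    qed
    then show "\<exists>U V. openin (seminorm_topology E P) U \<and> openin (seminorm_topology E P) V \<and>
                 x \<in> U \<and> y \<in> V \<and> disjnt U V"
      using openin_seminorm_ball[OF p(1) xy(1), of "r / 2"] openin_seminorm_ball[OF p(1) xy(2), of "r / 2"]
        r xy seminorm_on_zero[OF P[OF p(1)]]
      by (intro exI[of _ "{z \<in> E. p (z - x) < r / 2}"] exI[of _ "{z \<in> E. p (z - y) < r / 2}"])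
        (auto simp: disjnt_def)
  qed
  then show ?thesis
    unfolding locally_convex_space_def topspace_seminorm_topology
    using subspace_E vector_space_axioms P by blast
qed

end

section \<open>Seminorms dominated by integrals of functionals\<close>

text \<open>The integral of \<open>(cmod f - s)\<^sup>2\<close> is a nonnegative quadratic polynomial in \<open>s\<close>; its value at the
mean of \<open>cmod f\<close> gives the inequality.\<close>

lemma (in finite_measure) L1_le_L2:
  fixes f :: "'a \<Rightarrow> complex"
  assumes [measurable]: "f \<in> borel_measurable M" and bdd: "\<And>t. cmod (f t) \<le> K"
  shows "(\<integral>t. cmod (f t) \<partial>M) \<le> sqrt (measure M (space M)) * sqrt (\<integral>t. (cmod (f t))\<^sup>2 \<partial>M)"
proof -
  define m where "m = measure M (space M)"
  define a where "a = (\<integral>t. cmod (f t) \<partial>M)"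
  define b where "b = (\<integral>t. (cmod (f t))\<^sup>2 \<partial>M)"
  have i1: "integrable M (\<lambda>t. cmod (f t))"
    using bdd by (intro integrable_const_bound[where B = K]) auto
  have i2: "integrable M (\<lambda>t. (cmod (f t))\<^sup>2)"
    using bdd by (intro integrable_const_bound[where B = "K\<^sup>2"]) (auto intro!: power_mono)
  have quad: "0 \<le> b - 2 * s * a + s\<^sup>2 * m" for s
  proof -
    have "0 \<le> (\<integral>t. (cmod (f t) - s)\<^sup>2 \<partial>M)" by simp
    also have "\<dots> = (\<integral>t. (cmod (f t))\<^sup>2 - 2 * s * cmod (f t) + s\<^sup>2 \<partial>M)"
      by (intro Bochner_Integration.integral_cong) (auto simp: power2_diff)
    also have "\<dots> = b - 2 * s * a + s\<^sup>2 * m"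
      using i1 i2 by (simp add: a_def b_def m_def)
    finally show ?thesis .
  qed
  have a0: "0 \<le> a" by (simp add: a_def)
  have "a\<^sup>2 \<le> m * b"
  proof (cases "m = 0")
    case True
    have "a = 0"
    proof (rule ccontr)
      assume "a \<noteq> 0"
      then show False using quad[of "(b + 1) / (2 * a)"] True by simp
    qed
    then show ?thesis using True by simp
  next
    case False
    then have m: "m > 0" by (simp add: m_def less_le)
    have "b - 2 * (a / m) * a + (a / m)\<^sup>2 * m = b - a\<^sup>2 / m"
      using m by (simp add: power2_eq_square divide_simps)
    with quad[of "a / m"] have "a\<^sup>2 / m \<le> b" by linarith
    then show ?thesis using m by (simp add: field_simps)
  qed
  then show ?thesis
    using a0 real_le_rsqrt[of a "m * b"] by (simp add: a_def b_def m_def real_sqrt_mult)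
qed

text \<open>The inner product pulled back from a finite sum of copies of \<open>L\<^sup>2(M)\<close> along \<open>x \<mapsto> (t \<mapsto> \<psi> i t x)\<close>.\<close>

definition gram :: "('i \<Rightarrow> 't \<Rightarrow> 'a \<Rightarrow> complex) \<Rightarrow> 't measure \<Rightarrow> 'i set \<Rightarrow> 'a \<Rightarrow> 'a \<Rightarrow> complex" where
  "gram \<psi> M F x y = (\<Sum>i\<in>F. \<integral>t. \<psi> i t x * cnj (\<psi> i t y) \<partial>M)"

text \<open>The setting of the abstract criterion. The seminorms \<open>P i\<close> generate the topology, and each of
them is squeezed between a family of functionals and an integral of such functionals over a
finite measure space. The upper bound may use another index: it stands for a loss of
derivatives and of weight.\<close>

locale dominated_functionals = complex_subspace scl E + finite_measure M
  for scl :: "complex \<Rightarrow> 'a::ab_group_add \<Rightarrow> 'a" and E and M :: "'t measure" +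
  fixes I :: "'i set" and P :: "'i \<Rightarrow> 'a \<Rightarrow> real" and \<psi> :: "'i \<Rightarrow> 't \<Rightarrow> 'a \<Rightarrow> complex"
  assumes P_seminorm: "i \<in> I \<Longrightarrow> seminorm_on scl E (P i)"
    and P_separates: "x \<in> E \<Longrightarrow> (\<And>i. i \<in> I \<Longrightarrow> P i x = 0) \<Longrightarrow> x = 0"
    and \<psi>_add: "i \<in> I \<Longrightarrow> x \<in> E \<Longrightarrow> y \<in> E \<Longrightarrow> \<psi> i t (x + y) = \<psi> i t x + \<psi> i t y"
    and \<psi>_scl: "i \<in> I \<Longrightarrow> x \<in> E \<Longrightarrow> \<psi> i t (scl c x) = c * \<psi> i t x"
    and \<psi>_measurable: "i \<in> I \<Longrightarrow> x \<in> E \<Longrightarrow> (\<lambda>t. \<psi> i t x) \<in> borel_measurable M"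
    and \<psi>_le: "i \<in> I \<Longrightarrow> x \<in> E \<Longrightarrow> cmod (\<psi> i t x) \<le> P i x"
    and P_le: "i \<in> I \<Longrightarrow> \<exists>j\<in>I. \<exists>K. \<forall>x\<in>E. P i x \<le> K * (\<integral>t. cmod (\<psi> j t x) \<partial>M)"
begin

lemma P_nonneg: "i \<in> I \<Longrightarrow> x \<in> E \<Longrightarrow> 0 \<le> P i x"
  using P_seminorm by (auto simp: seminorm_on_def)

lemma integrable_\<psi>_mult:
  assumes "i \<in> I" "x \<in> E" "y \<in> E"
  shows "integrable M (\<lambda>t. \<psi> i t x * cnj (\<psi> i t y))"
proof (rule integrable_const_bound[where B = "P i x * P i y"])
  show "AE t in M. cmod (\<psi> i t x * cnj (\<psi> i t y)) \<le> P i x * P i y"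
    using assms by (auto simp: norm_mult intro!: mult_mono \<psi>_le P_nonneg)
  show "(\<lambda>t. \<psi> i t x * cnj (\<psi> i t y)) \<in> borel_measurable M"
    using assms
    by (intro borel_measurable_times \<psi>_measurable
        measurable_compose[OF \<psi>_measurable borel_measurable_continuous_onI[of cnj]] continuous_intros)
qed

lemma integrable_\<psi>_sq:
  assumes "i \<in> I" "x \<in> E"
  shows "integrable M (\<lambda>t. (cmod (\<psi> i t x))\<^sup>2)"
proof (rule integrable_const_bound[where B = "(P i x)\<^sup>2"])
  show "AE t in M. norm ((cmod (\<psi> i t x))\<^sup>2) \<le> (P i x)\<^sup>2"
    using assms by (auto intro!: power_mono \<psi>_le)
  show "(\<lambda>t. (cmod (\<psi> i t x))\<^sup>2) \<in> borel_measurable M"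
    using \<psi>_measurable[of i x] assms by measurable
qed

lemma gram_self:
  assumes "F \<subseteq> I" "x \<in> E"
  shows "gram \<psi> M F x x = of_real (\<Sum>i\<in>F. \<integral>t. (cmod (\<psi> i t x))\<^sup>2 \<partial>M)"
  by (simp add: gram_def mult_cnj_cmod flip: of_real_power)

lemma hermitian_gram:
  assumes "F \<subseteq> I"
  shows "hermitian_form scl E (gram \<psi> M F)"
proof unfold_locales
  fix x y z c assume x: "x \<in> E" and y: "y \<in> E"
  show "gram \<psi> M F (scl c x) y = c * gram \<psi> M F x y"
    using x y assms by (auto simp: gram_def sum_distrib_left \<psi>_scl subset_iff mult.assoc intro!: sum.cong)
  show "gram \<psi> M F y x = cnj (gram \<psi> M F x y)"
    unfolding gram_def cnj_sum Bochner_Integration.integral_cnj[symmetric] by (simp add: mult.commute)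
  { assume z: "z \<in> E"
    show "gram \<psi> M F (x + y) z = gram \<psi> M F x z + gram \<psi> M F y z"
      unfolding gram_def sum.distrib[symmetric]
    proof (rule sum.cong[OF refl])
      fix i assume "i \<in> F"
      then have i: "i \<in> I" using assms by blast
      show "(\<integral>t. \<psi> i t (x + y) * cnj (\<psi> i t z) \<partial>M) =
            (\<integral>t. \<psi> i t x * cnj (\<psi> i t z) \<partial>M) + (\<integral>t. \<psi> i t y * cnj (\<psi> i t z) \<partial>M)"
        using i x y z by (simp add: \<psi>_add distrib_right integrable_\<psi>_mult)
    qed }
next
  fix x assume "x \<in> E"
  then show "0 \<le> Re (gram \<psi> M F x x)"
    using assms by (simp add: gram_self sum_nonneg)
qed

lemma gram_norm_sq:
  assumes "F \<subseteq> I" "x \<in> E"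
  shows "(form_norm (gram \<psi> M F) x)\<^sup>2 = (\<Sum>i\<in>F. \<integral>t. (cmod (\<psi> i t x))\<^sup>2 \<partial>M)"
  using assms by (simp add: form_norm_def gram_self sum_nonneg)

definition dominating_index :: "'i \<Rightarrow> 'i" where
  "dominating_index i = (SOME j. j \<in> I \<and> (\<exists>K. \<forall>x\<in>E. P i x \<le> K * (\<integral>t. cmod (\<psi> j t x) \<partial>M)))"

lemma dominating_index_in: "i \<in> I \<Longrightarrow> dominating_index i \<in> I"
  and P_le_dominating_index: "i \<in> I \<Longrightarrow> \<exists>K. \<forall>x\<in>E. P i x \<le> K * (\<integral>t. cmod (\<psi> (dominating_index i) t x) \<partial>M)"
proof -
  assume "i \<in> I"
  then have "\<exists>j. j \<in> I \<and> (\<exists>K. \<forall>x\<in>E. P i x \<le> K * (\<integral>t. cmod (\<psi> j t x) \<partial>M))" using P_le by blast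
  from someI_ex[OF this] show "dominating_index i \<in> I" "\<exists>K. \<forall>x\<in>E. P i x \<le> K * (\<integral>t. cmod (\<psi> (dominating_index i) t x) \<partial>M)"
    by (auto simp: dominating_index_def)
qed

lemma P_le_gram:
  assumes F: "finite F" "F \<subseteq> I"
  shows "\<exists>L\<ge>0. \<forall>i\<in>F. \<forall>x\<in>E. P i x \<le> L * form_norm (gram \<psi> M (dominating_index ` F)) x"
proof -
  define m where "m = sqrt (measure M (space M))"
  have "\<exists>K. \<forall>i\<in>F. \<forall>x\<in>E. P i x \<le> K i * (\<integral>t. cmod (\<psi> (dominating_index i) t x) \<partial>M)"
    using P_le_dominating_index F(2) by (intro bchoice) blast
  then obtain K where K: "\<And>i x. i \<in> F \<Longrightarrow> x \<in> E \<Longrightarrow> P i x \<le> K i * (\<integral>t. cmod (\<psi> (dominating_index i) t x) \<partial>M)"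
    by blast
  define L where "L = (\<Sum>i\<in>F. \<bar>K i\<bar>) * m"
  have sub: "dominating_index ` F \<subseteq> I" using F(2) dominating_index_in by blast
  have m0: "m \<ge> 0" by (simp add: m_def)
  have "P i x \<le> L * form_norm (gram \<psi> M (dominating_index ` F)) x" if i: "i \<in> F" and x: "x \<in> E" for i x
  proof -
    have si: "dominating_index i \<in> I" using i F(2) dominating_index_in by blast
    have "P i x \<le> K i * (\<integral>t. cmod (\<psi> (dominating_index i) t x) \<partial>M)" by (rule K[OF i x])
    also have "\<dots> \<le> (\<Sum>i\<in>F. \<bar>K i\<bar>) * (m * sqrt (\<integral>t. (cmod (\<psi> (dominating_index i) t x))\<^sup>2 \<partial>M))"
    proof (rule mult_mono)
      have "K i \<le> \<bar>K i\<bar>" by simp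
      also have "\<dots> \<le> (\<Sum>i\<in>F. \<bar>K i\<bar>)" using i F(1) by (intro member_le_sum) auto
      finally show "K i \<le> (\<Sum>i\<in>F. \<bar>K i\<bar>)" .
      show "(\<integral>t. cmod (\<psi> (dominating_index i) t x) \<partial>M) \<le> m * sqrt (\<integral>t. (cmod (\<psi> (dominating_index i) t x))\<^sup>2 \<partial>M)"
        unfolding m_def using \<psi>_le[OF si x] \<psi>_measurable[OF si x] by (intro L1_le_L2) auto
    qed (auto intro!: sum_nonneg)
    also have "\<dots> = L * sqrt (\<integral>t. (cmod (\<psi> (dominating_index i) t x))\<^sup>2 \<partial>M)" by (simp add: L_def)
    also have "\<dots> \<le> L * sqrt ((form_norm (gram \<psi> M (dominating_index ` F)) x)\<^sup>2)"
    proof (intro mult_left_mono real_sqrt_le_mono)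
      show "(\<integral>t. (cmod (\<psi> (dominating_index i) t x))\<^sup>2 \<partial>M) \<le> (form_norm (gram \<psi> M (dominating_index ` F)) x)\<^sup>2"
        unfolding gram_norm_sq[OF sub x]
        using i F(1) by (intro member_le_sum[where f = "\<lambda>j. \<integral>t. (cmod (\<psi> j t x))\<^sup>2 \<partial>M"]) auto
      show "0 \<le> L" using m0 by (auto simp: L_def intro!: sum_nonneg mult_nonneg_nonneg)
    qed
    finally show ?thesis
      using hermitian_form.nm_nonneg[OF hermitian_gram[OF sub] x] by simp
  qed
  moreover have "0 \<le> L" using m0 by (auto simp: L_def intro!: sum_nonneg mult_nonneg_nonneg)
  ultimately show ?thesis by blast
qed

text \<open>The reason for working with functionals. If \<open>\<psi>\<close> is a functional with \<open>\<bar>\<psi> x\<bar> \<le> L \<parallel>x\<parallel>\<close>, then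
\<open>(\<Sum>k. \<bar>\<psi> e\<^sub>k\<bar>\<^sup>2) \<le> L\<^sup>2\<close> for every orthonormal family, as one sees by evaluating \<open>\<psi>\<close> at
\<open>\<Sum>k. cnj (\<psi> e\<^sub>k) e\<^sub>k\<close>. Integrating this over the finite measure space bounds the sum of the
squared norms of the \<open>e\<^sub>k\<close>.\<close>

lemma hilbert_schmidt_gram:
  assumes F: "finite F" "F \<subseteq> I"
  shows "hilbert_schmidt E (gram \<psi> M (dominating_index ` F)) (gram \<psi> M F)"
proof -
  let ?B = "gram \<psi> M (dominating_index ` F)"
  have sub: "dominating_index ` F \<subseteq> I" using F(2) dominating_index_in by blast
  interpret B: hermitian_form scl E ?B by (rule hermitian_gram[OF sub])
  obtain L where L: "L \<ge> 0" "\<And>i x. i \<in> F \<Longrightarrow> x \<in> E \<Longrightarrow> P i x \<le> L * B.nm x"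
    using P_le_gram[OF F] by blast
  show ?thesis
    unfolding hilbert_schmidt_def
  proof (intro exI allI impI)
    fix n e assume so: "suborthonormal E ?B {..<n} e"
    then have e: "\<And>k. k < n \<Longrightarrow> e k \<in> E" and e1: "\<And>k. k < n \<Longrightarrow> B.nm (e k) \<le> 1"
      by (auto simp: suborthonormal_def)
    have pointwise: "(\<Sum>k<n. (cmod (\<psi> i t (e k)))\<^sup>2) \<le> L\<^sup>2" if i: "i \<in> F" for i t
    proof -
      have iI: "i \<in> I" using i F(2) by blast
      define S where "S = (\<Sum>k<n. (cmod (\<psi> i t (e k)))\<^sup>2)"
      define x where "x = (\<Sum>k<n. scl (cnj (\<psi> i t (e k))) (e k))"
      have xE: "x \<in> E" using e by (auto simp: x_def intro!: closed_E)
      have S0: "S \<ge> 0" by (auto simp: S_def intro!: sum_nonneg)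
      have "\<psi> i t (\<Sum>k<m. scl (c k) (e k)) = (\<Sum>k<m. c k * \<psi> i t (e k))" if "m \<le> n" for m c
        using that
      proof (induction m)
        case 0
        then show ?case using \<psi>_scl[OF iI zero_E, of t 0] by simp
      next
        case (Suc m)
        then have "(\<Sum>k<m. scl (c k) (e k)) \<in> E" "e m \<in> E" using e by (auto intro!: closed_E)
        then show ?case using Suc by (simp add: \<psi>_add \<psi>_scl iI scl_E)
      qed
      then have "\<psi> i t x = of_real S"
        by (simp add: x_def S_def mult.commute[of "cnj _"] mult_cnj_cmod flip: of_real_power)
      then have "S \<le> P i x" using \<psi>_le[OF iI xE, of t] S0 by simp
      also have "\<dots> \<le> L * B.nm x" by (rule L(2)[OF i xE])
      also have "\<dots> \<le> L * sqrt S"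
      proof (rule mult_left_mono[OF _ L(1)], rule real_le_rsqrt)
        show "(B.nm x)\<^sup>2 \<le> S"
          unfolding x_def B.nm_sum_suborthonormal[OF finite_lessThan so] S_def
          using e e1 B.nm_nonneg by (intro sum_mono) (auto simp: power_le_one mult_left_le)
      qed
      finally have le: "sqrt S * sqrt S \<le> L * sqrt S" using S0 by simp
      have "sqrt S \<le> L"
      proof (cases "S = 0")
        case False
        with S0 have "sqrt S > 0" by simp
        with le show ?thesis by (rule mult_right_le_imp_le)
      qed (use L(1) in simp)
      then have "(sqrt S)\<^sup>2 \<le> L\<^sup>2" using S0 by (intro power_mono) auto
      then show ?thesis using S0 by (simp add: S_def)
    qed
    have "(\<Sum>k<n. (form_norm (gram \<psi> M F) (e k))\<^sup>2) = (\<Sum>k<n. \<Sum>i\<in>F. \<integral>t. (cmod (\<psi> i t (e k)))\<^sup>2 \<partial>M)"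
      using e by (intro sum.cong) (auto simp: gram_norm_sq F(2))
    also have "\<dots> = (\<Sum>i\<in>F. \<Sum>k<n. \<integral>t. (cmod (\<psi> i t (e k)))\<^sup>2 \<partial>M)"
      by (rule sum.swap)
    also have "\<dots> = (\<Sum>i\<in>F. \<integral>t. (\<Sum>k<n. (cmod (\<psi> i t (e k)))\<^sup>2) \<partial>M)"
      using e F(2) by (intro sum.cong Bochner_Integration.integral_sum[symmetric] integrable_\<psi>_sq) auto
    also have "\<dots> \<le> (\<Sum>i\<in>F. \<integral>t. L\<^sup>2 \<partial>M)"
      using e F(2) pointwise
      by (intro sum_mono integral_mono Bochner_Integration.integrable_sum integrable_\<psi>_sq) auto
    finally show "(\<Sum>k<n. (form_norm (gram \<psi> M F) (e k))\<^sup>2) \<le> (\<Sum>i\<in>F. \<integral>t. L\<^sup>2 \<partial>M)" .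
  qed
qed

lemma gram_norm_le_P:
  assumes F: "finite F" "F \<subseteq> I" and x: "x \<in> E"
  shows "form_norm (gram \<psi> M F) x \<le> sqrt (measure M (space M)) * (\<Sum>i\<in>F. P i x)"
proof -
  define m where "m = measure M (space M)"
  have Pn: "\<And>i. i \<in> F \<Longrightarrow> 0 \<le> P i x" using F(2) x P_nonneg by blast
  have "(form_norm (gram \<psi> M F) x)\<^sup>2 = (\<Sum>i\<in>F. \<integral>t. (cmod (\<psi> i t x))\<^sup>2 \<partial>M)"
    by (rule gram_norm_sq[OF F(2) x])
  also have "\<dots> \<le> (\<Sum>i\<in>F. \<integral>t. (P i x)\<^sup>2 \<partial>M)"
    using F(2) x by (intro sum_mono integral_mono integrable_\<psi>_sq) (auto intro!: power_mono \<psi>_le)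
  also have "\<dots> = m * (\<Sum>i\<in>F. (P i x)\<^sup>2)"
    by (simp add: m_def sum_distrib_left)
  also have "\<dots> \<le> m * (\<Sum>i\<in>F. P i x)\<^sup>2"
  proof (rule mult_left_mono)
    have "sqrt (\<Sum>i\<in>F. (P i x)\<^sup>2) \<le> (\<Sum>i\<in>F. P i x)"
      using L2_set_le_sum[of F "\<lambda>i. P i x"] Pn by (simp add: L2_set_def)
    then show "(\<Sum>i\<in>F. (P i x)\<^sup>2) \<le> (\<Sum>i\<in>F. P i x)\<^sup>2" by (rule sqrt_le_D)
  qed (simp add: m_def)
  finally have "(form_norm (gram \<psi> M F) x)\<^sup>2 \<le> (sqrt m * (\<Sum>i\<in>F. P i x))\<^sup>2"
    by (simp add: power_mult_distrib m_def)
  then show ?thesis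
    unfolding m_def by (rule power2_le_imp_le) (intro mult_nonneg_nonneg sum_nonneg Pn, auto)
qed

text \<open>Three steps up in the index set give three Hilbertian seminorms: the first dominates the given
seminorm, and the others dominate their predecessors in the Hilbert--Schmidt sense. The last one, rescaled
to lie above the given seminorm, is the required \<open>q\<close>.\<close>

theorem nuclear_space_seminorm_topology: "nuclear_space scl (seminorm_topology E (P ` I))"
  unfolding nuclear_space_def topspace_seminorm_topology
proof (intro conjI allI impI)
  show "locally_convex_space scl (seminorm_topology E (P ` I))"
    using P_seminorm P_separates by (intro locally_convex_space_seminorm_topology) auto
next
  fix p assume "seminorm_on scl E p \<and> continuous_map (seminorm_topology E (P ` I)) euclideanreal p"
  then have p: "seminorm_on scl E p" "continuous_map (seminorm_topology E (P ` I)) euclideanreal p" by auto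
  obtain F K where F: "finite F" "F \<subseteq> I" and K: "0 \<le> K" "\<And>x. x \<in> E \<Longrightarrow> p x \<le> K * (\<Sum>i\<in>F. P i x)"
    using continuous_seminorm_dominated[OF P_seminorm p] by blast
  define F1 F2 F3 where "F1 = dominating_index ` F" and "F2 = dominating_index ` F1" and "F3 = dominating_index ` F2"
  have F1: "finite F1" "F1 \<subseteq> I" and F2: "finite F2" "F2 \<subseteq> I" and F3: "finite F3" "F3 \<subseteq> I"
    using F dominating_index_in by (auto simp: F1_def F2_def F3_def)
  define A B D where "A = gram \<psi> M F1" and "B = gram \<psi> M F2" and "D = gram \<psi> M F3"
  have hA: "hermitian_form scl E A" and hB: "hermitian_form scl E B" and hD: "hermitian_form scl E D"
    using F1 F2 F3 by (auto simp: A_def B_def D_def intro: hermitian_gram)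
  have BA: "hilbert_schmidt E B A" and DB: "hilbert_schmidt E D B"
    using hilbert_schmidt_gram[OF F1] hilbert_schmidt_gram[OF F2]
    by (simp_all add: A_def B_def D_def F2_def F3_def)
  obtain L where L: "L \<ge> 0" "\<And>i x. i \<in> F \<Longrightarrow> x \<in> E \<Longrightarrow> P i x \<le> L * form_norm A x"
    using P_le_gram[OF F] by (auto simp: A_def F1_def)
  define K1 where "K1 = K * (card F * L)"
  have K1: "K1 \<ge> 0" using K L by (simp add: K1_def)
  have pA: "p x \<le> K1 * form_norm A x" if x: "x \<in> E" for x
  proof -
    have "p x \<le> K * (\<Sum>i\<in>F. P i x)" by (rule K(2)[OF x])
    also have "\<dots> \<le> K * (\<Sum>i\<in>F. L * form_norm A x)"
      using K(1) L(2)[OF _ x] by (intro mult_left_mono sum_mono) auto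
    finally show ?thesis by (simp add: K1_def mult.assoc)
  qed
  obtain K2 where K2: "K2 \<ge> 0" "\<And>x. x \<in> E \<Longrightarrow> form_norm A x \<le> K2 * form_norm B x"
    using hilbert_schmidt_dominated[OF hA hB BA] by blast
  obtain K3 where K3: "K3 \<ge> 0" "\<And>x. x \<in> E \<Longrightarrow> form_norm B x \<le> K3 * form_norm D x"
    using hilbert_schmidt_dominated[OF hB hD DB] by blast
  define c where "c = K1 * (K2 * K3) + 1"
  have c: "c \<ge> 1" using K1 K2 K3 by (simp add: c_def)
  define q where "q x = c * form_norm D x" for x
  have Dn: "0 \<le> form_norm D x" if "x \<in> E" for x
    using hermitian_form.nm_nonneg[OF hD that] .
  have q: "seminorm_on scl E q"
    unfolding q_def using c hermitian_form.seminorm_on_nm[OF hD] by (intro seminorm_on_scale) auto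
  have Dq: "form_norm D x \<le> q x" if "x \<in> E" for x
    using mult_right_mono[OF c Dn[OF that]] by (simp add: q_def)
  have pq: "p x \<le> q x" if x: "x \<in> E" for x
  proof -
    have "p x \<le> K1 * form_norm A x" by (rule pA[OF x])
    also have "\<dots> \<le> K1 * (K2 * form_norm B x)" by (rule mult_left_mono[OF K2(2)[OF x] K1])
    also have "\<dots> \<le> K1 * (K2 * (K3 * form_norm D x))"
      by (intro mult_left_mono K3(2)[OF x] K1 K2(1))
    also have "\<dots> \<le> q x" using Dn[OF x] by (simp add: q_def c_def algebra_simps)
    finally show ?thesis .
  qed
  have "continuous_map (seminorm_topology E (P ` I)) euclideanreal q"
  proof (rule continuous_seminormI[OF P_seminorm q F3])
    fix x assume x: "x \<in> E"
    show "q x \<le> c * sqrt (measure M (space M)) * (\<Sum>i\<in>F3. P i x)"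
      using mult_left_mono[OF gram_norm_le_P[OF F3 x], of c] c by (simp add: q_def D_def mult.assoc)
  qed (use c in auto)
  moreover have "nuclear_linking_map scl E q p"
    by (rule nuclear_linking_map_via_forms[OF hA hB hD BA DB p(1) pA K1 q Dq])
  ultimately show "\<exists>q. seminorm_on scl E q \<and> continuous_map (seminorm_topology E (P ` I)) euclideanreal q \<and>
          (\<forall>x\<in>E. p x \<le> q x) \<and> nuclear_linking_map scl E q p"
    using q pq by blast
qed

end

section \<open>Symmetry of mixed partial derivatives\<close>

lemma smooth_partial_deriv: "smooth u \<Longrightarrow> smooth (partial_deriv i u)"
  unfolding smooth_def using foldr_append[of partial_deriv _ "[i]" u]
  by (metis foldr.simps comp_apply id_apply)

lemma smooth_foldr_partial_deriv: "smooth u \<Longrightarrow> smooth (foldr partial_deriv is u)"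
  by (induction "is") (auto intro: smooth_partial_deriv)

lemma smooth_imp_continuous: "smooth u \<Longrightarrow> continuous_on UNIV u"
  unfolding smooth_def by (metis foldr.simps(1) id_apply)

lemma smooth_has_vector_derivative:
  assumes "smooth u"
  shows "((\<lambda>t. u (x + t *\<^sub>R axis i 1)) has_vector_derivative partial_deriv i u (x + s *\<^sub>R axis i 1)) (at s)"
proof -
  let ?y = "x + s *\<^sub>R axis i 1"
  have "(\<lambda>t. foldr partial_deriv [] u (?y + t *\<^sub>R axis i 1)) differentiable (at 0)"
    using assms unfolding smooth_def by blast
  then have "((\<lambda>t. u (?y + t *\<^sub>R axis i 1)) has_vector_derivative partial_deriv i u ?y) (at (s - s))"
    by (simp add: partial_deriv_def vector_derivative_works)
  then have "((\<lambda>t. u (?y + t *\<^sub>R axis i 1)) \<circ> (\<lambda>t. t - s) has_vector_derivative 1 *\<^sub>R partial_deriv i u ?y) (at s)"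
    by (intro vector_diff_chain_at) (auto intro!: derivative_eq_intros)
  moreover have "(\<lambda>t. u (?y + t *\<^sub>R axis i 1)) \<circ> (\<lambda>t. t - s) = (\<lambda>t. u (x + t *\<^sub>R axis i 1))"
    by (auto simp: algebra_simps)
  ultimately show ?thesis by simp
qed

text \<open>Schwarz's theorem for continuous iterated partial derivatives. The increment of \<open>u\<close> in
direction \<open>i\<close> is an integral of \<open>\<partial>\<^sub>i u\<close>; differentiating under the integral sign in direction
\<open>j\<close>, and then with respect to the upper limit at zero, exchanges the two derivatives.\<close>

lemma partial_deriv_commute:
  assumes u: "smooth u"
  shows "partial_deriv i (partial_deriv j u) = partial_deriv j (partial_deriv i u)"
proof
  fix x
  let ?e = "\<lambda>i. axis i (1::real)"
  have cont: "continuous_on UNIV (partial_deriv j (partial_deriv i u))"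
    by (intro smooth_imp_continuous smooth_partial_deriv u)
  define h where "h s = partial_deriv j (partial_deriv i u) (x + s *\<^sub>R ?e i)" for s
  have line: "(\<lambda>s. partial_deriv i u (y + s *\<^sub>R ?e i)) integrable_on {0..a}" for a y
    by (intro integrable_continuous_real continuous_on_compose2[OF smooth_imp_continuous[OF smooth_partial_deriv[OF u]]]
        continuous_intros) auto
  have incr: "partial_deriv j u (x + a *\<^sub>R ?e i) - partial_deriv j u x = integral {0..a} h" if a: "0 \<le> a" for a
  proof -
    have ftc: "u (x + t *\<^sub>R ?e j + a *\<^sub>R ?e i) - u (x + t *\<^sub>R ?e j) =
        integral {0..a} (\<lambda>s. partial_deriv i u (x + t *\<^sub>R ?e j + s *\<^sub>R ?e i))" for t
    proof -
      have "((\<lambda>s. partial_deriv i u (x + t *\<^sub>R ?e j + s *\<^sub>R ?e i)) has_integral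
          u (x + t *\<^sub>R ?e j + a *\<^sub>R ?e i) - u (x + t *\<^sub>R ?e j + 0 *\<^sub>R ?e i)) {0..a}"
        by (rule fundamental_theorem_of_calculus[OF a])
          (rule has_vector_derivative_at_within[OF smooth_has_vector_derivative[OF u]])
      then show ?thesis by (simp add: integral_unique)
    qed
    have "((\<lambda>t. integral (cbox 0 a) (\<lambda>s. partial_deriv i u (x + t *\<^sub>R ?e j + s *\<^sub>R ?e i)))
        has_vector_derivative
          integral (cbox 0 a) (\<lambda>s. partial_deriv j (partial_deriv i u) (x + 0 *\<^sub>R ?e j + s *\<^sub>R ?e i))) (at 0 within UNIV)"
    proof (rule leibniz_rule_vector_derivative)
      fix t s :: real
      show "((\<lambda>t. partial_deriv i u (x + t *\<^sub>R ?e j + s *\<^sub>R ?e i)) has_vector_derivative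
          partial_deriv j (partial_deriv i u) (x + t *\<^sub>R ?e j + s *\<^sub>R ?e i)) (at t within UNIV)"
        using smooth_has_vector_derivative[OF smooth_partial_deriv[OF u, of i], of "x + s *\<^sub>R ?e i" j t]
        by (simp add: algebra_simps)
      show "(\<lambda>s. partial_deriv i u (x + t *\<^sub>R ?e j + s *\<^sub>R ?e i)) integrable_on cbox 0 a"
        using line by simp
    next
      show "continuous_on (UNIV \<times> cbox 0 a)
         (\<lambda>(t, s). partial_deriv j (partial_deriv i u) (x + t *\<^sub>R ?e j + s *\<^sub>R ?e i))"
        unfolding split_beta by (rule continuous_on_compose2[OF cont]) (auto intro!: continuous_intros)
    qed auto
    then have "((\<lambda>t. u (x + t *\<^sub>R ?e j + a *\<^sub>R ?e i) - u (x + t *\<^sub>R ?e j)) has_vector_derivative integral {0..a} h) (at 0)"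
      by (simp add: ftc h_def[abs_def])
    moreover have "((\<lambda>t. u (x + t *\<^sub>R ?e j + a *\<^sub>R ?e i) - u (x + t *\<^sub>R ?e j)) has_vector_derivative
        partial_deriv j u (x + a *\<^sub>R ?e i) - partial_deriv j u x) (at 0)"
      using has_vector_derivative_diff[OF smooth_has_vector_derivative[OF u, of "x + a *\<^sub>R ?e i" j 0]
          smooth_has_vector_derivative[OF u, of x j 0]]
      by (simp add: add_ac)
    ultimately show ?thesis by (simp add: vector_derivative_unique_at)
  qed
  have hc: "continuous_on {0..1} h"
    unfolding h_def by (rule continuous_on_compose2[OF cont]) (auto intro!: continuous_intros)
  have "((\<lambda>a. partial_deriv j u (x + a *\<^sub>R ?e i) - partial_deriv j u x) has_vector_derivative
      partial_deriv i (partial_deriv j u) x) (at 0 within {0..1})"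
    using has_vector_derivative_diff[OF smooth_has_vector_derivative[OF smooth_partial_deriv[OF u, of j], of x i 0]
        has_vector_derivative_const[of "partial_deriv j u x"]]
    by (simp add: has_vector_derivative_at_within)
  moreover have "((\<lambda>a. partial_deriv j u (x + a *\<^sub>R ?e i) - partial_deriv j u x) has_vector_derivative h 0) (at 0 within {0..1})"
    by (rule has_vector_derivative_transform[OF _ _ integral_has_vector_derivative[OF hc]]) (auto simp: incr)
  ultimately have "partial_deriv i (partial_deriv j u) x = h 0"
    by (rule vector_derivative_unique_within[rotated]) (simp add: trivial_limit_within islimpt_Icc)
  then show "partial_deriv i (partial_deriv j u) x = partial_deriv j (partial_deriv i u) x"
    by (simp add: h_def)
qed

lemma foldr_partial_deriv_permute:
  assumes "smooth u" "mset is = mset js"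
  shows "foldr partial_deriv is u = foldr partial_deriv js u"
  unfolding foldr_conv_fold
  by (rule fold_permuted_eq[where P = smooth])
    (use assms in \<open>auto intro: smooth_partial_deriv partial_deriv_commute\<close>)

lemma ex_list_with_counts:
  fixes \<alpha> :: "nat ^ 'n::finite"
  shows "\<exists>is. \<forall>i. count_list is i = \<alpha> $ i"
proof -
  obtain "is" where "mset is = (\<Sum>i\<in>UNIV. replicate_mset (\<alpha> $ i) i)"
    using ex_mset by blast
  then have "count_list is i = \<alpha> $ i" for i
    by (simp add: count_sum flip: count_mset)
  then show ?thesis by blast
qed

text \<open>By symmetry, every sequence of directions with the right multiplicities computes the
derivative.\<close>

lemma multi_deriv_eq_foldr:
  assumes "smooth u" "\<And>i. count_list is i = \<alpha> $ i"
  shows "multi_deriv \<alpha> u = foldr partial_deriv is u"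
proof -
  have "\<forall>i. count_list (SOME is. \<forall>i. count_list is i = \<alpha> $ i) i = \<alpha> $ i"
    by (rule someI_ex[OF ex_list_with_counts])
  then show ?thesis
    unfolding multi_deriv_def using assms
    by (intro foldr_partial_deriv_permute) (auto simp: multiset_eq_iff count_mset)
qed

lemma multi_deriv_zero [simp]: "multi_deriv 0 u = u"
proof -
  have "(SOME is :: 'a list. \<forall>i. count_list is i = (0 :: nat ^ 'a) $ i) = []"
    by (rule some_equality) (auto simp: count_list_0_iff)
  then show ?thesis by (simp add: multi_deriv_def)
qed

section \<open>Weighted pointwise bounds by integrals of derivatives\<close>

text \<open>A function that vanishes at infinity is minus the integral of its derivative from \<open>a\<close> to
\<open>\<infinity>\<close>. Moving away from the origin only increases the weight, so it can be pulled into the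
integral.\<close>

lemma weighted_le_integral_of_derivative_nonneg:
  fixes g g' :: "real \<Rightarrow> complex" and w :: "real \<Rightarrow> real"
  assumes g: "\<And>t. (g has_vector_derivative g' t) (at t)" and g': "continuous_on UNIV g'"
    and lim: "(g \<longlongrightarrow> 0) at_top"
    and w: "0 \<le> w a" "\<And>t. a \<le> t \<Longrightarrow> w a \<le> w t"
  shows "ennreal (w a * cmod (g a)) \<le> (\<integral>\<^sup>+t. ennreal (w t * cmod (g' t)) \<partial>lborel)"
proof (rule tendsto_upperbound)
  have "((\<lambda>T. w a * cmod (g T - g a)) \<longlongrightarrow> w a * cmod (0 - g a)) at_top"
    by (intro tendsto_intros lim)
  then show "((\<lambda>T. ennreal (w a * cmod (g T - g a))) \<longlongrightarrow> ennreal (w a * cmod (g a))) at_top"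
    by (intro tendsto_ennrealI) simp
  have [measurable]: "g' \<in> borel_measurable borel" by (rule borel_measurable_continuous_onI[OF g'])
  show "\<forall>\<^sub>F T in at_top. ennreal (w a * cmod (g T - g a)) \<le> (\<integral>\<^sup>+t. ennreal (w t * cmod (g' t)) \<partial>lborel)"
    using eventually_ge_at_top[of a]
  proof eventually_elim
    case (elim T)
    have cont: "continuous_on {a..T} g'" using g' continuous_on_subset by blast
    have eq: "(\<integral>t. indicator {a..T} t *\<^sub>R g' t \<partial>lborel) = g T - g a"
      by (rule integral_FTC_atLeastAtMost[OF elim has_vector_derivative_at_within[OF g] cont])
    have int: "integrable lborel (\<lambda>t. indicator {a..T} t *\<^sub>R g' t)"
      using borel_integrable_compact[OF compact_Icc cont] by simp
    have "ennreal (w a * cmod (g T - g a)) = ennreal (w a) * ennreal (cmod (\<integral>t. indicator {a..T} t *\<^sub>R g' t \<partial>lborel))"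
      using w by (simp add: eq ennreal_mult)
    also have "\<dots> \<le> ennreal (w a) * (\<integral>\<^sup>+t. ennreal (cmod (indicator {a..T} t *\<^sub>R g' t)) \<partial>lborel)"
      by (intro mult_left_mono integral_norm_bound_ennreal int) auto
    also have "\<dots> = (\<integral>\<^sup>+t. ennreal (w a) * ennreal (cmod (indicator {a..T} t *\<^sub>R g' t)) \<partial>lborel)"
      by (intro nn_integral_cmult[symmetric]) auto
    also have "\<dots> \<le> (\<integral>\<^sup>+t. ennreal (w t * cmod (g' t)) \<partial>lborel)"
    proof (intro nn_integral_mono)
      fix t
      show "ennreal (w a) * ennreal (cmod (indicator {a..T} t *\<^sub>R g' t)) \<le> ennreal (w t * cmod (g' t))"
        using w by (cases "t \<in> {a..T}") (auto simp: ennreal_mult[symmetric] intro!: ennreal_leI mult_right_mono)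
    qed
    finally show ?case .
  qed
qed simp

text \<open>For negative \<open>a\<close> one integrates towards \<open>- \<infinity>\<close>, which again is the direction of growing
weight.\<close>

lemma weighted_le_integral_of_derivative:
  fixes g g' :: "real \<Rightarrow> complex" and w :: "real \<Rightarrow> real"
  assumes g: "\<And>t. (g has_vector_derivative g' t) (at t)" and g': "continuous_on UNIV g'"
    and lim: "(g \<longlongrightarrow> 0) at_infinity"
    and w: "\<And>t. 0 \<le> w t" "\<And>s t. \<bar>s\<bar> \<le> \<bar>t\<bar> \<Longrightarrow> w s \<le> w t" and wm: "w \<in> borel_measurable borel"
  shows "ennreal (w a * cmod (g a)) \<le> (\<integral>\<^sup>+t. ennreal (w t * cmod (g' t)) \<partial>lborel)"
proof (cases "0 \<le> a")
  case True
  then show ?thesis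
    using tendsto_mono[OF at_top_le_at_infinity lim]
    by (intro weighted_le_integral_of_derivative_nonneg[OF g g' _ w(1) w(2)]) auto
next
  case False
  have [measurable]: "g' \<in> borel_measurable borel" "w \<in> borel_measurable borel"
    using borel_measurable_continuous_onI[OF g'] wm by auto
  have even: "w (- t) = w t" for t using w(2)[of t "-t"] w(2)[of "-t" t] by simp
  have "ennreal (w (- a) * cmod (g (- (- a)))) \<le> (\<integral>\<^sup>+t. ennreal (w t * cmod (- g' (- t))) \<partial>lborel)"
  proof (rule weighted_le_integral_of_derivative_nonneg[where w = w and g = "\<lambda>t. g (- t)" and a = "- a"])
    fix t
    have "(uminus has_vector_derivative - 1) (at t)"
      using has_vector_derivative_minus[OF has_vector_derivative_id[of "at t"]] by simp
    from vector_diff_chain_at[OF this g]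
    show "((\<lambda>t. g (- t)) has_vector_derivative - g' (- t)) (at t)"
      by (simp add: o_def)
  next
    show "continuous_on UNIV (\<lambda>t. - g' (- t))"
      by (intro continuous_intros continuous_on_compose2[OF g']) auto
    have "filterlim (\<lambda>t::real. - t) at_infinity at_top"
      using filterlim_uminus_at_bot_at_top at_bot_le_at_infinity filterlim_mono by blast
    from filterlim_compose[OF lim this] show "((\<lambda>t. g (- t)) \<longlongrightarrow> 0) at_top" .
  qed (use False w in auto)
  also have "(\<integral>\<^sup>+t. ennreal (w t * cmod (- g' (- t))) \<partial>lborel) = (\<integral>\<^sup>+t. ennreal (w t * cmod (g' t)) \<partial>lborel)"
    by (subst nn_integral_real_affine[where c = "-1" and t = 0]) (auto simp: even)
  finally show ?thesis by (simp add: even)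
qed

text \<open>A finite measure equivalent to Lebesgue measure. Its powers turn integrals over Euclidean space
into integrals over a finite measure space, at the price of a polynomial factor.\<close>

definition arctan_measure :: "real measure" where
  "arctan_measure = density lborel (\<lambda>t. ennreal (inverse (1 + t\<^sup>2)))"

lemma sets_arctan_measure [simp, measurable_cong]: "sets arctan_measure = sets borel"
  by (simp add: arctan_measure_def)

lemma space_arctan_measure [simp]: "space arctan_measure = UNIV"
  by (simp add: arctan_measure_def)

lemma finite_measure_arctan_measure: "finite_measure arctan_measure"
proof
  let ?f = "\<lambda>t::real. ennreal (inverse (1 + t\<^sup>2))"
  have half: "(\<integral>\<^sup>+t. ?f t * indicator {0..} t \<partial>lborel) = ennreal (pi / 2)"
    using nn_integral_FTC_atLeast[of "\<lambda>t. inverse (1 + t\<^sup>2)" 0 arctan "pi / 2"]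
    by (simp add: DERIV_arctan tendsto_arctan_at_top)
  have "emeasure arctan_measure (space arctan_measure) = (\<integral>\<^sup>+t. ?f t \<partial>lborel)"
    by (simp add: arctan_measure_def emeasure_density)
  also have "\<dots> \<le> (\<integral>\<^sup>+t. ?f t * indicator {0..} t + ?f (- t) * indicator {0..} (- t) \<partial>lborel)"
    by (intro nn_integral_mono) (auto simp: indicator_def)
  also have "\<dots> = (\<integral>\<^sup>+t. ?f t * indicator {0..} t \<partial>lborel) + (\<integral>\<^sup>+t. ?f (- t) * indicator {0..} (- t) \<partial>lborel)"
    by (intro nn_integral_add) auto
  also have "(\<integral>\<^sup>+t. ?f (- t) * indicator {0..} (- t) \<partial>lborel) = (\<integral>\<^sup>+t. ?f t * indicator {0..} t \<partial>lborel)"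
    using nn_integral_real_affine[of "\<lambda>t. ?f t * indicator {0..} t" "-1" 0] by simp
  finally have "emeasure arctan_measure (space arctan_measure) \<le> ennreal (pi / 2) + ennreal (pi / 2)"
    unfolding half .
  then show "emeasure arctan_measure (space arctan_measure) \<noteq> \<infinity>"
    by (metis ennreal_add_eq_top ennreal_neq_top infinity_ennreal_def top.extremum_unique)
qed

lemma nn_integral_lborel_arctan_measure:
  assumes "f \<in> borel_measurable borel" "\<And>t. 0 \<le> f t"
  shows "(\<integral>\<^sup>+t. ennreal (f t) \<partial>lborel) = (\<integral>\<^sup>+t. ennreal ((1 + t\<^sup>2) * f t) \<partial>arctan_measure)"
proof -
  have "1 + t\<^sup>2 \<noteq> 0" for t :: real by (simp add: add_nonneg_eq_0_iff)
  then show ?thesis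
    unfolding arctan_measure_def using assms
    by (subst nn_integral_density) (auto simp: ennreal_mult[symmetric] mult.assoc[symmetric])
qed

interpretation arctan_product: product_sigma_finite "\<lambda>_. arctan_measure"
  by (rule product_sigma_finite.intro) (rule finite_measure.axioms(1)[OF finite_measure_arctan_measure])

lemma finite_measure_PiM_arctan: "finite J \<Longrightarrow> finite_measure (PiM J (\<lambda>_. arctan_measure))"
proof
  assume J: "finite J"
  have "emeasure (PiM J (\<lambda>_. arctan_measure)) (space (PiM J (\<lambda>_. arctan_measure))) =
      (\<Prod>i\<in>J. emeasure arctan_measure (space arctan_measure))"
    unfolding space_PiM using J by (intro arctan_product.emeasure_PiM) auto
  then show "emeasure (PiM J (\<lambda>_. arctan_measure)) (space (PiM J (\<lambda>_. arctan_measure))) \<noteq> \<infinity>"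
    using finite_measure.emeasure_finite[OF finite_measure_arctan_measure, of UNIV]
    by (simp add: power_eq_top_ennreal)
qed

definition replace_coords :: "'n set \<Rightarrow> ('n \<Rightarrow> real) \<Rightarrow> real ^ 'n \<Rightarrow> real ^ 'n" where
  "replace_coords J s x = (\<chi> i. if i \<in> J then s i else x $ i)"

lemma measurable_replace_coords:
  fixes x :: "real ^ 'n::finite"
  shows "(\<lambda>s. replace_coords J s x) \<in> borel_measurable (PiM J (\<lambda>_. arctan_measure))"
proof -
  have "(\<lambda>s. replace_coords J s x $ i) \<in> borel_measurable (PiM J (\<lambda>_. arctan_measure))" for i
  proof (cases "i \<in> J")
    case True
    then have "(\<lambda>s. s i) \<in> measurable (PiM J (\<lambda>_. arctan_measure)) arctan_measure"
      by (rule measurable_component_singleton)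
    then show ?thesis using True by (simp add: replace_coords_def cong: measurable_cong_sets)
  qed (simp add: replace_coords_def)
  then show ?thesis
    by (subst borel_measurable_euclidean_space) (auto simp: Basis_vec_def inner_axis)
qed

text \<open>The one-dimensional estimate, applied in one direction after the other. Each application
replaces a coordinate of the point by an integration variable, adds one derivative, and
multiplies the weight by the factor that converts Lebesgue measure to \<open>arctan_measure\<close>. This
factor is even and grows with the coordinate, so the hypothesis on the weight persists.\<close>

lemma weighted_le_integral_of_mixed_derivative:
  fixes v :: "real ^ 'n::finite \<Rightarrow> complex"
  assumes v: "smooth v" "\<And>is. (foldr partial_deriv is v \<longlongrightarrow> 0) at_infinity"
    and W: "\<And>x. 0 \<le> W x" "\<And>x y. (\<And>i. \<bar>x $ i\<bar> \<le> \<bar>y $ i\<bar>) \<Longrightarrow> W x \<le> W y"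
    and Wm: "W \<in> borel_measurable borel"
    and "distinct is"
  shows "ennreal (W x * cmod (v x)) \<le>
    (\<integral>\<^sup>+s. (let z = replace_coords (set is) s x in
        ennreal (W z * (\<Prod>i\<in>set is. 1 + (z $ i)\<^sup>2) * cmod (foldr partial_deriv is v z)))
      \<partial>PiM (set is) (\<lambda>_. arctan_measure))"
  using \<open>distinct is\<close>
proof (induction "is")
  case Nil
  then show ?case
    by (simp add: PiM_empty replace_coords_def)
next
  case (Cons j "is")
  let ?D = "foldr partial_deriv is v"
  define W' where "W' z = W z * (\<Prod>i\<in>set is. 1 + (z $ i)\<^sup>2)" for z
  have j: "j \<notin> set is" and dist: "distinct is" using Cons.prems by auto
  have sm: "smooth ?D" by (rule smooth_foldr_partial_deriv[OF v(1)])
  have cont': "continuous_on UNIV (partial_deriv j ?D)"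
    by (intro smooth_imp_continuous smooth_partial_deriv sm)
  have W'0: "0 \<le> W' z" for z using W(1) by (auto simp: W'_def intro!: mult_nonneg_nonneg prod_nonneg)
  have W'mono: "W' y \<le> W' z" if "\<And>i. \<bar>y $ i\<bar> \<le> \<bar>z $ i\<bar>" for y z
    unfolding W'_def using that W
    by (intro mult_mono prod_mono conjI prod_nonneg add_left_mono) (auto simp: abs_le_square_iff[symmetric])
  have W'm [measurable]: "W' \<in> borel_measurable borel"
    unfolding W'_def
    by (intro borel_measurable_times[OF Wm] borel_measurable_continuous_onI continuous_intros)
  have Dm [measurable]: "partial_deriv j ?D \<in> borel_measurable borel"
    by (rule borel_measurable_continuous_onI[OF cont'])
  define f where "f s = (let z = replace_coords (set (j # is)) s x in
      ennreal ((1 + (z $ j)\<^sup>2) * (W' z * cmod (partial_deriv j ?D z))))" for s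
  have step: "ennreal (W' z * cmod (?D z)) \<le> (\<integral>\<^sup>+t. f (s(j := t)) \<partial>arctan_measure)"
    if z: "z = replace_coords (set is) s x" for z s
  proof -
    \<comment> \<open>The line through \<open>z\<close> in direction \<open>j\<close>, parametrised by its \<open>j\<close>-th coordinate.\<close>
    define y where "y t = z + (t - z $ j) *\<^sub>R axis j 1" for t
    have y_nth: "y t $ i = (if i = j then t else z $ i)" for t i
      by (simp add: y_def axis_def)
    have yz: "y t = replace_coords (set (j # is)) (s(j := t)) x" for t
      using j by (auto simp: vec_eq_iff y_nth z replace_coords_def)
    have yc: "continuous_on UNIV y" unfolding y_def by (intro continuous_intros)
    then have ym [measurable]: "y \<in> borel_measurable borel" by (rule borel_measurable_continuous_onI)
    have "ennreal (W' (y (z $ j)) * cmod (?D (y (z $ j)))) \<le>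
        (\<integral>\<^sup>+t. ennreal (W' (y t) * cmod (partial_deriv j ?D (y t))) \<partial>lborel)"
    proof (rule weighted_le_integral_of_derivative)
      fix t
      show "((\<lambda>t. ?D (y t)) has_vector_derivative partial_deriv j ?D (y t)) (at t)"
        using smooth_has_vector_derivative[OF sm, of "z - (z $ j) *\<^sub>R axis j 1" j t]
        by (simp add: y_def algebra_simps)
    next
      show "continuous_on UNIV (\<lambda>t. partial_deriv j ?D (y t))"
        by (rule continuous_on_compose2[OF cont' yc]) auto
      have "filterlim y at_infinity at_infinity"
      proof (subst filterlim_at_infinity[OF order_refl], intro allI impI)
        fix r :: real assume "0 < r"
        have "\<bar>t\<bar> \<le> norm (y t)" for t using component_le_norm_cart[of "y t" j] by (simp add: y_nth)
        then show "\<forall>\<^sub>F t in at_infinity. r \<le> norm (y t)"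
          unfolding eventually_at_infinity real_norm_def by (meson order_trans)
      qed
      from filterlim_compose[OF v(2) this] show "((\<lambda>t. ?D (y t)) \<longlongrightarrow> 0) at_infinity" .
    next
      fix t r :: real assume "\<bar>t\<bar> \<le> \<bar>r\<bar>"
      then show "W' (y t) \<le> W' (y r)" by (intro W'mono) (auto simp: y_nth)
    qed (use W'0 in auto)
    also have "y (z $ j) = z" by (simp add: y_def)
    also have "(\<integral>\<^sup>+t. ennreal (W' (y t) * cmod (partial_deriv j ?D (y t))) \<partial>lborel) =
       (\<integral>\<^sup>+t. ennreal ((1 + t\<^sup>2) * (W' (y t) * cmod (partial_deriv j ?D (y t)))) \<partial>arctan_measure)"
      by (rule nn_integral_lborel_arctan_measure) (auto intro!: mult_nonneg_nonneg W'0)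
    also have "\<dots> = (\<integral>\<^sup>+t. f (s(j := t)) \<partial>arctan_measure)"
      unfolding f_def yz[symmetric] by (simp add: y_nth Let_def)
    finally show ?thesis .
  qed
  have fm: "f \<in> borel_measurable (PiM (insert j (set is)) (\<lambda>_. arctan_measure))"
  proof -
    have "(\<lambda>z. ennreal ((1 + (z $ j)\<^sup>2) * (W' z * cmod (partial_deriv j ?D z)))) \<in> borel_measurable borel"
      by measurable
    from measurable_compose[OF measurable_replace_coords this] show ?thesis
      by (simp add: f_def[abs_def] Let_def)
  qed
  have "ennreal (W x * cmod (v x)) \<le>
    (\<integral>\<^sup>+s. (let z = replace_coords (set is) s x in ennreal (W' z * cmod (?D z))) \<partial>PiM (set is) (\<lambda>_. arctan_measure))"
    using Cons.IH[OF dist] by (simp add: W'_def)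
  also have "\<dots> \<le> (\<integral>\<^sup>+s. (\<integral>\<^sup>+t. f (s(j := t)) \<partial>arctan_measure) \<partial>PiM (set is) (\<lambda>_. arctan_measure))"
    by (intro nn_integral_mono) (auto simp: Let_def intro!: step)
  also have "\<dots> = integral\<^sup>N (PiM (insert j (set is)) (\<lambda>_. arctan_measure)) f"
    by (rule arctan_product.product_nn_integral_insert[symmetric]) (use j fm in auto)
  also have "\<dots> = (\<integral>\<^sup>+s. (let z = replace_coords (set (j # is)) s x in
        ennreal (W z * (\<Prod>i\<in>set (j # is). 1 + (z $ i)\<^sup>2) * cmod (foldr partial_deriv (j # is) v z)))
      \<partial>PiM (set (j # is)) (\<lambda>_. arctan_measure))"
    using j by (simp add: f_def[abs_def] W'_def Let_def mult_ac)
  finally show ?case .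
qed

section \<open>Linearity of derivatives and of the Fourier transform\<close>

lemma partial_deriv_add:
  assumes "smooth u" "smooth v"
  shows "partial_deriv i (u + v) = partial_deriv i u + partial_deriv i v"
proof
  fix x
  have "((\<lambda>t. u (x + t *\<^sub>R axis i 1) + v (x + t *\<^sub>R axis i 1)) has_vector_derivative
      partial_deriv i u x + partial_deriv i v x) (at 0)"
    using has_vector_derivative_add[OF smooth_has_vector_derivative[OF assms(1), of x i 0]
        smooth_has_vector_derivative[OF assms(2), of x i 0]] by simp
  then show "partial_deriv i (u + v) x = (partial_deriv i u + partial_deriv i v) x"
    by (simp add: partial_deriv_def[of i "u + v"] vector_derivative_at)
qed

lemma partial_deriv_fun_scale:
  assumes "smooth u"
  shows "partial_deriv i (fun_scale c u) = fun_scale c (partial_deriv i u)"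
proof
  fix x
  have "((\<lambda>t. c * u (x + t *\<^sub>R axis i 1)) has_vector_derivative c * partial_deriv i u x) (at 0)"
    using has_vector_derivative_mult_right[OF smooth_has_vector_derivative[OF assms, of x i 0], of c] by simp
  then show "partial_deriv i (fun_scale c u) x = fun_scale c (partial_deriv i u) x"
    unfolding partial_deriv_def[of i "fun_scale c u"] by (simp add: fun_scale_def vector_derivative_at)
qed

lemma foldr_partial_deriv_add:
  "smooth u \<Longrightarrow> smooth v \<Longrightarrow> foldr partial_deriv is (u + v) = foldr partial_deriv is u + foldr partial_deriv is v"
  by (induction "is") (simp_all add: partial_deriv_add smooth_foldr_partial_deriv)

lemma foldr_partial_deriv_fun_scale:
  "smooth u \<Longrightarrow> foldr partial_deriv is (fun_scale c u) = fun_scale c (foldr partial_deriv is u)"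
  by (induction "is") (simp_all add: partial_deriv_fun_scale smooth_foldr_partial_deriv)

lemma smooth_add:
  assumes "smooth u" "smooth v"
  shows "smooth (u + v)"
  unfolding smooth_def[of "u + v"] foldr_partial_deriv_add[OF assms]
  unfolding plus_fun_def
  by (intro allI conjI continuous_intros differentiable_add smooth_imp_continuous smooth_foldr_partial_deriv assms
      differentiableI_vector[OF smooth_has_vector_derivative])

lemma smooth_fun_scale:
  assumes "smooth u"
  shows "smooth (fun_scale c u)"
  unfolding smooth_def[of "fun_scale c u"] foldr_partial_deriv_fun_scale[OF assms]
  unfolding fun_scale_def
  by (intro allI conjI continuous_intros differentiable_mult differentiable_const smooth_imp_continuous
      smooth_foldr_partial_deriv assms differentiableI_vector[OF smooth_has_vector_derivative])

lemma multi_deriv_add: "smooth u \<Longrightarrow> smooth v \<Longrightarrow> multi_deriv \<alpha> (u + v) = multi_deriv \<alpha> u + multi_deriv \<alpha> v"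
  by (simp add: multi_deriv_def foldr_partial_deriv_add)

lemma multi_deriv_fun_scale: "smooth u \<Longrightarrow> multi_deriv \<alpha> (fun_scale c u) = fun_scale c (multi_deriv \<alpha> u)"
  by (simp add: multi_deriv_def foldr_partial_deriv_fun_scale)

lemma continuous_on_multi_deriv: "smooth u \<Longrightarrow> continuous_on UNIV (multi_deriv \<alpha> u)"
  unfolding multi_deriv_def by (intro smooth_imp_continuous smooth_foldr_partial_deriv)

lemma integrable_fourier_integrand:
  fixes u :: "real ^ 'n::finite \<Rightarrow> complex"
  assumes "integrable lborel u"
  shows "integrable lborel (\<lambda>x. u x * exp (- \<i> * of_real (x \<bullet> \<xi>)))"
proof (rule Bochner_Integration.integrable_bound[OF assms])
  have "(\<lambda>x. exp (- \<i> * of_real (x \<bullet> \<xi>)) :: complex) \<in> borel_measurable borel"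
    by (intro borel_measurable_continuous_onI continuous_intros)
  then show "(\<lambda>x. u x * exp (- \<i> * of_real (x \<bullet> \<xi>))) \<in> borel_measurable lborel"
    using assms by (intro borel_measurable_times) auto
qed (simp add: norm_mult)

lemma fourier_add:
  "integrable lborel u \<Longrightarrow> integrable lborel v \<Longrightarrow> fourier (u + v) = fourier u + fourier v"
  unfolding fourier_def plus_fun_def distrib_right
  by (intro ext Bochner_Integration.integral_add integrable_fourier_integrand)

lemma fourier_fun_scale: "fourier (fun_scale c u) = fun_scale c (fourier u)"
  by (simp add: fun_eq_iff fourier_def fun_scale_def mult.assoc)

section \<open>Rapidly decreasing functions\<close>

text \<open>The condition that the definition of the space imposes both on a function and on its Fourier
transform.\<close>

definition rapidly_decreasing :: "(real \<Rightarrow> real) \<Rightarrow> (real ^ 'n::finite \<Rightarrow> complex) \<Rightarrow> bool" where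
  "rapidly_decreasing \<omega> v \<longleftrightarrow> smooth v \<and>
     (\<forall>r>0. \<forall>\<alpha>. bdd_above (range (\<lambda>x. exp (r * \<omega> (norm x)) * cmod (multi_deriv \<alpha> v x))))"

lemma S_space_eq:
  "S_space \<omega> = {u. integrable lborel u \<and> rapidly_decreasing \<omega> u \<and> rapidly_decreasing \<omega> (fourier u)}"
  by (auto simp: S_space_def rapidly_decreasing_def)

lemma weighted_sup_upper:
  assumes "rapidly_decreasing \<omega> v" "0 < r"
  shows "exp (r * \<omega> (norm x)) * cmod (multi_deriv \<alpha> v x) \<le> weighted_sup \<omega> r \<alpha> v"
  unfolding weighted_sup_def using assms by (intro cSUP_upper) (auto simp: rapidly_decreasing_def)

lemma weighted_sup_least:
  assumes "\<And>x. exp (r * \<omega> (norm x)) * cmod (multi_deriv \<alpha> v x) \<le> K"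
  shows "weighted_sup \<omega> r \<alpha> v \<le> K"
  unfolding weighted_sup_def using assms by (intro cSUP_least) auto

lemma weighted_sup_nonneg: "rapidly_decreasing \<omega> v \<Longrightarrow> 0 < r \<Longrightarrow> 0 \<le> weighted_sup \<omega> r \<alpha> v"
  by (rule order_trans[OF _ weighted_sup_upper[of _ _ _ 0]]) auto

lemma weighted_pointwise_add:
  assumes "rapidly_decreasing \<omega> u" "rapidly_decreasing \<omega> v" "0 < r"
  shows "exp (r * \<omega> (norm x)) * cmod (multi_deriv \<alpha> (u + v) x) \<le> weighted_sup \<omega> r \<alpha> u + weighted_sup \<omega> r \<alpha> v"
proof -
  have "exp (r * \<omega> (norm x)) * cmod (multi_deriv \<alpha> (u + v) x) \<le>
      exp (r * \<omega> (norm x)) * (cmod (multi_deriv \<alpha> u x) + cmod (multi_deriv \<alpha> v x))"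
    using assms by (intro mult_left_mono) (auto simp: multi_deriv_add rapidly_decreasing_def norm_triangle_ineq)
  also have "\<dots> \<le> weighted_sup \<omega> r \<alpha> u + weighted_sup \<omega> r \<alpha> v"
    unfolding distrib_left by (intro add_mono weighted_sup_upper assms)
  finally show ?thesis .
qed

lemma weighted_pointwise_fun_scale:
  assumes "rapidly_decreasing \<omega> u"
  shows "exp (r * \<omega> (norm x)) * cmod (multi_deriv \<alpha> (fun_scale c u) x) =
    cmod c * (exp (r * \<omega> (norm x)) * cmod (multi_deriv \<alpha> u x))"
proof -
  have "smooth u" using assms by (simp add: rapidly_decreasing_def)
  from multi_deriv_fun_scale[OF this] show ?thesis by (simp only:) (simp add: fun_scale_def norm_mult)
qed

lemma rapidly_decreasing_add:
  assumes "rapidly_decreasing \<omega> u" "rapidly_decreasing \<omega> v"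
  shows "rapidly_decreasing \<omega> (u + v)"
  using assms smooth_add weighted_pointwise_add[OF assms]
  by (auto simp: rapidly_decreasing_def[of _ "u + v"] intro!: bdd_aboveI2) (auto simp: rapidly_decreasing_def)

lemma rapidly_decreasing_fun_scale:
  assumes "rapidly_decreasing \<omega> u"
  shows "rapidly_decreasing \<omega> (fun_scale c u)"
  unfolding rapidly_decreasing_def
proof (intro conjI allI impI)
  show "smooth (fun_scale c u)" using assms by (simp add: rapidly_decreasing_def smooth_fun_scale)
  fix r :: real and \<alpha> assume "0 < r"
  then show "bdd_above (range (\<lambda>x. exp (r * \<omega> (norm x)) * cmod (multi_deriv \<alpha> (fun_scale c u) x)))"
    by (intro bdd_aboveI2[where M = "cmod c * weighted_sup \<omega> r \<alpha> u"])
      (auto simp: weighted_pointwise_fun_scale[OF assms] intro!: mult_left_mono weighted_sup_upper assms)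
qed

lemma weighted_sup_add:
  assumes "rapidly_decreasing \<omega> u" "rapidly_decreasing \<omega> v" "0 < r"
  shows "weighted_sup \<omega> r \<alpha> (u + v) \<le> weighted_sup \<omega> r \<alpha> u + weighted_sup \<omega> r \<alpha> v"
  by (intro weighted_sup_least weighted_pointwise_add assms)

lemma weighted_sup_fun_scale:
  fixes u :: "real ^ 'n::finite \<Rightarrow> complex"
  assumes u: "rapidly_decreasing \<omega> u" and r: "0 < r"
  shows "weighted_sup \<omega> r \<alpha> (fun_scale c u) = cmod c * weighted_sup \<omega> r \<alpha> u"
proof (rule antisym)
  have le: "weighted_sup \<omega> r \<alpha> (fun_scale c u) \<le> cmod c * weighted_sup \<omega> r \<alpha> u"
    if "rapidly_decreasing \<omega> u" for c and u :: "real ^ 'n \<Rightarrow> complex"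
    by (intro weighted_sup_least)
      (auto simp: weighted_pointwise_fun_scale[OF that] intro!: mult_left_mono weighted_sup_upper that r)
  show "weighted_sup \<omega> r \<alpha> (fun_scale c u) \<le> cmod c * weighted_sup \<omega> r \<alpha> u" by (rule le[OF u])
  show "cmod c * weighted_sup \<omega> r \<alpha> u \<le> weighted_sup \<omega> r \<alpha> (fun_scale c u)"
  proof (cases "c = 0")
    case True
    then show ?thesis using weighted_sup_nonneg[OF rapidly_decreasing_fun_scale[OF u, of c] r] by simp
  next
    case False
    have "u = fun_scale (inverse c) (fun_scale c u)" using False by (simp add: fun_scale_def fun_eq_iff)
    then have "weighted_sup \<omega> r \<alpha> u \<le> cmod (inverse c) * weighted_sup \<omega> r \<alpha> (fun_scale c u)"
      using le[OF rapidly_decreasing_fun_scale[OF u, of c], of "inverse c"] by simp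
    then show ?thesis using False by (simp add: norm_inverse norm_divide field_simps)
  qed
qed

lemma vector_space_fun_scale: "vector_space fun_scale"
  by unfold_locales (auto simp: fun_scale_def fun_eq_iff algebra_simps)

lemma rapidly_decreasing_zero: "rapidly_decreasing \<omega> (0 :: real ^ 'n::finite \<Rightarrow> complex)"
proof -
  have z: "foldr partial_deriv is (0 :: real ^ 'n \<Rightarrow> complex) = 0" for "is" :: "'n list"
    by (induction "is") (auto simp: fun_eq_iff partial_deriv_def)
  have "smooth (0 :: real ^ 'n \<Rightarrow> complex)" 
    unfolding smooth_def z unfolding zero_fun_def by simp
  then show ?thesis by (simp add: rapidly_decreasing_def multi_deriv_def z)
qed

lemma subspace_S_space: "module.subspace fun_scale (S_space \<omega> :: (real ^ 'n::finite \<Rightarrow> complex) set)"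
proof -
  interpret vector_space "fun_scale :: complex \<Rightarrow> (real ^ 'n \<Rightarrow> complex) \<Rightarrow> _"
    by (rule vector_space_fun_scale)
  have "fourier 0 = (0 :: real ^ 'n \<Rightarrow> complex)" by (simp add: fourier_def fun_eq_iff)
  then have "0 \<in> (S_space \<omega> :: (real ^ 'n \<Rightarrow> complex) set)"
    by (simp add: S_space_eq rapidly_decreasing_zero) (simp add: zero_fun_def)
  moreover have "u + v \<in> S_space \<omega>" if "u \<in> S_space \<omega>" "v \<in> S_space \<omega>" for u v :: "real ^ 'n \<Rightarrow> complex"
  proof -
    have "integrable lborel (u + v)" using that by (simp add: S_space_eq plus_fun_def)
    then show ?thesis using that by (simp add: S_space_eq fourier_add rapidly_decreasing_add)
  qed
  moreover have "fun_scale c u \<in> S_space \<omega>" if "u \<in> S_space \<omega>" for c and u :: "real ^ 'n \<Rightarrow> complex"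
  proof -
    have "integrable lborel (fun_scale c u)" using that by (simp add: S_space_eq fun_scale_def)
    then show ?thesis using that by (simp add: S_space_eq fourier_fun_scale rapidly_decreasing_fun_scale)
  qed
  ultimately show ?thesis unfolding subspace_def by blast
qed

lemma complex_subspace_S_space: "complex_subspace fun_scale (S_space \<omega> :: (real ^ 'n::finite \<Rightarrow> complex) set)"
  using vector_space_fun_scale subspace_S_space
  by (auto simp: complex_subspace_def complex_subspace_axioms_def)

section \<open>Domination of the seminorms by integrals\<close>

context
  fixes \<omega> :: "real \<Rightarrow> real"
  assumes \<omega>: "weight_function \<omega>"
begin

lemma weight_mono: "0 \<le> s \<Longrightarrow> s \<le> t \<Longrightarrow> \<omega> s \<le> \<omega> t"
  using \<omega> by (auto simp: weight_function_def mono_on_def)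

lemma weight_log: "\<exists>a. \<exists>b>0. \<forall>t\<ge>0. \<omega> t \<ge> a + b * ln (1 + t)"
  using \<omega> by (simp add: weight_function_def)

lemma continuous_on_exp_weight: "continuous_on UNIV (\<lambda>x :: real ^ 'n::finite. exp (r * \<omega> (norm x)))"
proof -
  have c: "continuous_on {0..} \<omega>" using \<omega> by (simp add: weight_function_def)
  have "continuous_on UNIV (\<lambda>x :: real ^ 'n. \<omega> (norm x))"
    by (rule continuous_on_compose2[OF c continuous_on_norm_id]) auto
  then show ?thesis by (intro continuous_intros)
qed

text \<open>The logarithmic lower bound makes the weight tend to infinity, so that a bound for the weighted
derivative is a rate of decay.\<close>

lemma rapidly_decreasing_tendsto_zero:
  fixes v :: "real ^ 'n::finite \<Rightarrow> complex"
  assumes "rapidly_decreasing \<omega> v"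
  shows "(foldr partial_deriv is v \<longlongrightarrow> 0) at_infinity"
proof -
  obtain a b where b: "b > 0" and ab: "\<And>t. t \<ge> 0 \<Longrightarrow> \<omega> t \<ge> a + b * ln (1 + t)"
    using weight_log by blast
  define \<alpha> :: "nat ^ 'n" where "\<alpha> = (\<chi> i. count_list is i)"
  have D: "foldr partial_deriv is v = multi_deriv \<alpha> v"
    using assms by (intro multi_deriv_eq_foldr[symmetric]) (auto simp: rapidly_decreasing_def \<alpha>_def)
  define C where "C = weighted_sup \<omega> 1 \<alpha> v"
  have bound: "cmod (multi_deriv \<alpha> v x) \<le> C * exp (- (a + b * ln (1 + norm x)))" for x
  proof -
    define y where "y = a + b * ln (1 + norm x)"
    have "exp y * cmod (multi_deriv \<alpha> v x) \<le> exp (1 * \<omega> (norm x)) * cmod (multi_deriv \<alpha> v x)"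
      using ab[of "norm x"] by (intro mult_right_mono) (auto simp: y_def)
    also have "\<dots> \<le> C" unfolding C_def by (rule weighted_sup_upper[OF assms]) simp
    finally show ?thesis unfolding y_def[symmetric] by (simp add: exp_minus field_simps)
  qed
  have "filterlim (\<lambda>x :: real ^ 'n. a + b * ln (1 + norm x)) at_top at_infinity"
    by (intro filterlim_tendsto_add_at_top[OF tendsto_const] filterlim_tendsto_pos_mult_at_top[OF tendsto_const b]
        filterlim_compose[OF ln_at_top] filterlim_norm_at_top)
  then have "filterlim (\<lambda>x :: real ^ 'n. - (a + b * ln (1 + norm x))) at_bot at_infinity"
    by (simp add: filterlim_uminus_at_top)
  from tendsto_mult[OF tendsto_const filterlim_compose[OF exp_at_bot this], of C]
  have "((\<lambda>x :: real ^ 'n. C * exp (- (a + b * ln (1 + norm x)))) \<longlongrightarrow> 0) at_infinity" by simp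
  then show ?thesis
    unfolding D by (rule Lim_null_comparison[rotated]) (intro always_eventually allI bound)
qed

text \<open>The polynomial factor produced by the pointwise estimate is absorbed by \<open>exp (\<kappa> * \<omega>)\<close>,
because \<open>\<omega>\<close> grows at least like a multiple of the logarithm.\<close>

lemma weighted_sup_le_integral:
  "\<exists>\<kappa>>0. \<exists>K. \<forall>v r \<alpha>. rapidly_decreasing \<omega> (v :: real ^ 'n::finite \<Rightarrow> complex) \<longrightarrow> 0 < r \<longrightarrow>
     weighted_sup \<omega> r \<alpha> v \<le> K * (\<integral>s. exp ((r + \<kappa>) * \<omega> (norm (vec_lambda s))) *
        cmod (multi_deriv (\<chi> i. Suc (\<alpha> $ i)) v (vec_lambda s)) \<partial>PiM UNIV (\<lambda>_. arctan_measure))"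
proof -
  obtain a b where b: "b > 0" and ab: "\<And>t. t \<ge> 0 \<Longrightarrow> \<omega> t \<ge> a + b * ln (1 + t)"
    using weight_log by blast
  \<comment> \<open>Chosen such that \<open>(1 + t) ^ (2 * CARD('n)) \<le> exp (\<kappa> * (\<omega> t - a))\<close>.\<close>
  define \<kappa> where "\<kappa> = 2 * real CARD('n) / b"
  define K where "K = exp (- \<kappa> * a)"
  let ?M = "PiM (UNIV :: 'n set) (\<lambda>_. arctan_measure)"
  interpret M: finite_measure ?M by (rule finite_measure_PiM_arctan) simp
  have \<kappa>: "\<kappa> > 0" using b by (simp add: \<kappa>_def)
  have prod_le: "(\<Prod>i\<in>UNIV. 1 + (z $ i)\<^sup>2) \<le> K * exp (\<kappa> * \<omega> (norm z))" for z :: "real ^ 'n"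
  proof -
    have "(\<Prod>i\<in>UNIV. 1 + (z $ i)\<^sup>2) \<le> (\<Prod>i\<in>(UNIV :: 'n set). (1 + norm z)\<^sup>2)"
    proof (rule prod_mono, intro conjI)
      fix i
      have "\<bar>z $ i\<bar> \<le> \<bar>norm z\<bar>" using component_le_norm_cart[of z i] by simp
      then have "(z $ i)\<^sup>2 \<le> (norm z)\<^sup>2" by (simp only: abs_le_square_iff)
      then show "1 + (z $ i)\<^sup>2 \<le> (1 + norm z)\<^sup>2" by (simp add: power2_sum add_increasing2)
    qed simp
    also have "\<dots> = (1 + norm z) ^ (2 * CARD('n))" by (simp add: power_mult)
    also have "\<dots> = exp (real (2 * CARD('n)) * ln (1 + norm z))"
      by (subst exp_of_nat_mult) (simp add: add_pos_nonneg)
    also have "\<dots> = exp (\<kappa> * (b * ln (1 + norm z)))" using b by (simp add: \<kappa>_def)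
    also have "\<dots> \<le> exp (\<kappa> * (\<omega> (norm z) - a))" using ab[of "norm z"] \<kappa> by simp
    also have "\<dots> = K * exp (\<kappa> * \<omega> (norm z))" by (simp add: K_def algebra_simps flip: exp_add)
    finally show ?thesis .
  qed
  have "weighted_sup \<omega> r \<alpha> v \<le> K * (\<integral>s. exp ((r + \<kappa>) * \<omega> (norm (vec_lambda s))) *
        cmod (multi_deriv (\<chi> i. Suc (\<alpha> $ i)) v (vec_lambda s)) \<partial>?M)"
    if v: "rapidly_decreasing \<omega> v" and r: "0 < r" for v :: "real ^ 'n \<Rightarrow> complex" and r \<alpha>
  proof -
    have smv: "smooth v" using v by (simp add: rapidly_decreasing_def)
    define \<alpha>' :: "nat ^ 'n" where "\<alpha>' = (\<chi> i. Suc (\<alpha> $ i))"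
    define h where "h s = exp ((r + \<kappa>) * \<omega> (norm (vec_lambda s))) * cmod (multi_deriv \<alpha>' v (vec_lambda s))" for s :: "'n \<Rightarrow> real"
    obtain js where js: "\<And>i. count_list js i = \<alpha> $ i" using ex_list_with_counts by blast
    obtain ds where ds: "set ds = (UNIV :: 'n set)" "distinct ds"
      using finite_distinct_list[of "UNIV :: 'n set"] by auto
    have "count_list ds i = 1" for i
      using ds by (simp add: distinct_count_atmost_1 flip: count_mset)
    then have D': "multi_deriv \<alpha>' v = foldr partial_deriv ds (foldr partial_deriv js v)"
      using multi_deriv_eq_foldr[OF smv, of "ds @ js" \<alpha>'] js by (simp add: \<alpha>'_def)
    have D: "multi_deriv \<alpha> v = foldr partial_deriv js v" by (rule multi_deriv_eq_foldr[OF smv js])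
    define g where "g z = exp ((r + \<kappa>) * \<omega> (norm z)) * cmod (multi_deriv \<alpha>' v z)" for z
    have gc: "continuous_on UNIV g"
      unfolding g_def by (intro continuous_intros continuous_on_exp_weight continuous_on_multi_deriv smv)
    have vl: "vec_lambda s = replace_coords UNIV s 0" for s :: "'n \<Rightarrow> real"
      by (simp add: replace_coords_def)
    have hm: "h \<in> borel_measurable ?M"
      using measurable_compose[OF measurable_replace_coords[of UNIV 0] borel_measurable_continuous_onI[OF gc]]
      by (simp add: h_def[abs_def] g_def vl)
    have hi: "integrable ?M h"
      using weighted_sup_upper[OF v, of "r + \<kappa>"] r \<kappa>
      by (intro M.integrable_const_bound[OF _ hm, where B = "weighted_sup \<omega> (r + \<kappa>) \<alpha>' v"]) (auto simp: h_def)
    have h0: "0 \<le> (\<integral>s. h s \<partial>?M)" by (simp add: h_def)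
    have "exp (r * \<omega> (norm x)) * cmod (multi_deriv \<alpha> v x) \<le> K * (\<integral>s. h s \<partial>?M)" for x
    proof -
      have "ennreal (exp (r * \<omega> (norm x)) * cmod (foldr partial_deriv js v x)) \<le>
        (\<integral>\<^sup>+s. (let z = replace_coords (set ds) s x in
            ennreal (exp (r * \<omega> (norm z)) * (\<Prod>i\<in>set ds. 1 + (z $ i)\<^sup>2) *
              cmod (foldr partial_deriv ds (foldr partial_deriv js v) z))) \<partial>PiM (set ds) (\<lambda>_. arctan_measure))"
      proof (rule weighted_le_integral_of_mixed_derivative)
        show "smooth (foldr partial_deriv js v)" by (rule smooth_foldr_partial_deriv[OF smv])
        show "(foldr partial_deriv is (foldr partial_deriv js v) \<longlongrightarrow> 0) at_infinity" for "is"
          using rapidly_decreasing_tendsto_zero[OF v, of "is @ js"] by simp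
        show "exp (r * \<omega> (norm y)) \<le> exp (r * \<omega> (norm z))" if "\<And>i. \<bar>y $ i\<bar> \<le> \<bar>z $ i\<bar>" for y z :: "real ^ 'n"
        proof -
          have "norm y \<le> norm z" using that by (simp add: norm_vec_def L2_set_mono)
          then show ?thesis using r by (simp add: weight_mono)
        qed
        show "(\<lambda>x :: real ^ 'n. exp (r * \<omega> (norm x))) \<in> borel_measurable borel"
          by (intro borel_measurable_continuous_onI continuous_on_exp_weight)
      qed (use ds in auto)
      also have "\<dots> = (\<integral>\<^sup>+s. ennreal (exp (r * \<omega> (norm (vec_lambda s))) * (\<Prod>i\<in>UNIV. 1 + (s i)\<^sup>2) *
            cmod (multi_deriv \<alpha>' v (vec_lambda s))) \<partial>?M)"
        by (simp add: ds D' replace_coords_def Let_def)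
      also have "\<dots> \<le> (\<integral>\<^sup>+s. ennreal (K * h s) \<partial>?M)"
      proof (intro nn_integral_mono ennreal_leI)
        fix s :: "'n \<Rightarrow> real"
        have "exp (r * \<omega> (norm (vec_lambda s))) * (\<Prod>i\<in>UNIV. 1 + (s i)\<^sup>2) \<le>
            exp (r * \<omega> (norm (vec_lambda s))) * (K * exp (\<kappa> * \<omega> (norm (vec_lambda s))))"
          using prod_le[of "vec_lambda s"] by (intro mult_left_mono) auto
        also have "\<dots> = K * exp ((r + \<kappa>) * \<omega> (norm (vec_lambda s)))" by (simp add: exp_add algebra_simps)
        finally show "exp (r * \<omega> (norm (vec_lambda s))) * (\<Prod>i\<in>UNIV. 1 + (s i)\<^sup>2) *
            cmod (multi_deriv \<alpha>' v (vec_lambda s)) \<le> K * h s"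
          unfolding h_def by (simp add: mult_right_mono mult.assoc[symmetric])
      qed
      also have "\<dots> = ennreal (\<integral>s. K * h s \<partial>?M)"
        by (intro nn_integral_eq_integral integrable_mult_right hi) (auto simp: K_def h_def)
      also have "(\<integral>s. K * h s \<partial>?M) = K * (\<integral>s. h s \<partial>?M)" by simp
      finally show ?thesis
        using h0 by (subst (asm) ennreal_le_iff) (auto simp: D K_def)
    qed
    then show ?thesis unfolding h_def \<alpha>'_def by (rule weighted_sup_least)
  qed
  then show ?thesis using \<kappa> by blast
qed

text \<open>The functionals are the weighted point evaluations of the derivatives of \<open>u\<close> (index \<open>False\<close>) and
of its Fourier transform (index \<open>True\<close>).\<close>

lemma dominated_functionals_S_space:
  "dominated_functionals fun_scale (S_space \<omega> :: (real ^ 'n::finite \<Rightarrow> complex) set)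
     (PiM UNIV (\<lambda>_. arctan_measure)) {(b, r, \<alpha>). 0 < r}
     (\<lambda>(b, r, \<alpha>) u. weighted_sup \<omega> r \<alpha> (if b then fourier u else u))
     (\<lambda>(b, r, \<alpha>) s u. of_real (exp (r * \<omega> (norm (vec_lambda s)))) *
        multi_deriv \<alpha> (if b then fourier u else u) (vec_lambda s))"
  (is "dominated_functionals _ ?E ?M ?I ?P ?\<psi>")
proof -
  let ?T = "\<lambda>b (u :: real ^ 'n \<Rightarrow> complex). if b then fourier u else u"
  have T_add: "?T b (u + v) = ?T b u + ?T b v" if "u \<in> ?E" "v \<in> ?E" for b u v
    using that by (simp add: S_space_eq fourier_add)
  have T_scale: "?T b (fun_scale c u) = fun_scale c (?T b u)" for b c u
    by (simp add: fourier_fun_scale)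
  have T_rd: "rapidly_decreasing \<omega> (?T b u)" if "u \<in> ?E" for b u
    using that by (simp add: S_space_eq)
  have T_sm: "smooth (?T b u)" if "u \<in> ?E" for b u
    using T_rd[OF that, of b] by (simp add: rapidly_decreasing_def)
  interpret complex_subspace fun_scale ?E by (rule complex_subspace_S_space)
  interpret M: finite_measure ?M by (rule finite_measure_PiM_arctan) simp
  obtain \<kappa> K where \<kappa>: "\<kappa> > 0" and K: "\<And>v r \<alpha>. rapidly_decreasing \<omega> (v :: real ^ 'n \<Rightarrow> complex) \<Longrightarrow> 0 < r \<Longrightarrow>
     weighted_sup \<omega> r \<alpha> v \<le> K * (\<integral>s. exp ((r + \<kappa>) * \<omega> (norm (vec_lambda s))) *
        cmod (multi_deriv (\<chi> i. Suc (\<alpha> $ i)) v (vec_lambda s)) \<partial>?M)"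
    using weighted_sup_le_integral by blast
  show ?thesis
  proof unfold_locales
    fix i :: "bool \<times> real \<times> (nat ^ 'n)" assume i: "i \<in> ?I"
    obtain b r \<alpha> where [simp]: "i = (b, r, \<alpha>)" by (cases i)
    have r: "0 < r" using i by simp
    show "seminorm_on fun_scale ?E (?P i)"
      unfolding seminorm_on_def
      by (simp add: T_add T_scale T_rd r weighted_sup_nonneg weighted_sup_add weighted_sup_fun_scale del: if_split)
    fix u assume u: "u \<in> ?E"
    show "cmod (?\<psi> i s u) \<le> ?P i u" for s
      using weighted_sup_upper[OF T_rd[OF u, of b] r, of "vec_lambda s" \<alpha>] by (simp add: norm_mult)
    show "?\<psi> i s (fun_scale c u) = c * ?\<psi> i s u" for s c
      by (simp only: T_scale multi_deriv_fun_scale[OF T_sm[OF u]] \<open>i = _\<close> prod.case) (simp add: fun_scale_def)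
    show "?\<psi> i s (u + v) = ?\<psi> i s u + ?\<psi> i s v" if v: "v \<in> ?E" for s v
      by (simp only: T_add[OF u v] multi_deriv_add[OF T_sm[OF u] T_sm[OF v]] \<open>i = _\<close> prod.case)
        (simp add: distrib_left)
    have cont: "continuous_on UNIV (\<lambda>z. of_real (exp (r * \<omega> (norm z))) * multi_deriv \<alpha> (?T b u) z)"
      by (intro continuous_intros continuous_on_exp_weight continuous_on_multi_deriv T_sm u)
    have vl: "vec_lambda s = replace_coords UNIV s 0" for s :: "'n \<Rightarrow> real"
      by (simp add: replace_coords_def)
    show "(\<lambda>s. ?\<psi> i s u) \<in> borel_measurable ?M"
      using measurable_compose[OF measurable_replace_coords[of UNIV 0] borel_measurable_continuous_onI[OF cont]]
      by (simp add: vl)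
  next
    fix u assume u: "u \<in> ?E" and z: "\<And>i. i \<in> ?I \<Longrightarrow> ?P i u = 0"
    have "exp (1 * \<omega> (norm x)) * cmod (u x) \<le> 0" for x
      using weighted_sup_upper[of \<omega> u 1 x 0] T_rd[OF u, of False] z[of "(False, 1, 0)"] by simp
    then show "u = 0" by (auto simp: fun_eq_iff mult_le_0_iff not_le)
  next
    fix i :: "bool \<times> real \<times> (nat ^ 'n)" assume i: "i \<in> ?I"
    obtain b r \<alpha> where [simp]: "i = (b, r, \<alpha>)" by (cases i)
    have r: "0 < r" using i by simp
    have "?P i u \<le> K * (\<integral>s. cmod (?\<psi> (b, r + \<kappa>, \<chi> i. Suc (\<alpha> $ i)) s u) \<partial>?M)" if "u \<in> ?E" for u
      using K[OF T_rd[OF that, of b] r, of \<alpha>] by (simp add: norm_mult)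
    moreover have "(b, r + \<kappa>, \<chi> i. Suc (\<alpha> $ i)) \<in> ?I" using r \<kappa> by simp
    ultimately show "\<exists>j\<in>?I. \<exists>K. \<forall>u\<in>?E. ?P i u \<le> K * (\<integral>s. cmod (?\<psi> j s u) \<partial>?M)" by blast
  qed
qed

end

section \<open>Nuclearity\<close>

theorem theorem3p3:
  fixes \<omega> :: "real \<Rightarrow> real"
  assumes "weight_function \<omega>"
  shows "nuclear_space fun_scale (S_topology \<omega> :: (real ^ 'n::finite \<Rightarrow> complex) topology)"
proof -
  let ?P = "\<lambda>(b, r, \<alpha>) (u :: real ^ 'n \<Rightarrow> complex). weighted_sup \<omega> r \<alpha> (if b then fourier u else u)"
  have "S_seminorms \<omega> = ?P ` {(b, r, \<alpha>). 0 < r}"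
  proof (intro subset_antisym subsetI)
    fix p :: "(real ^ 'n \<Rightarrow> complex) \<Rightarrow> real" assume "p \<in> S_seminorms \<omega>"
    then consider r \<alpha> where "0 < r" "p = weighted_sup \<omega> r \<alpha>"
      | r \<alpha> where "0 < r" "p = (\<lambda>u. weighted_sup \<omega> r \<alpha> (fourier u))"
      by (auto simp: S_seminorms_def)
    then show "p \<in> ?P ` {(b, r, \<alpha>). 0 < r}"
    proof cases
      case 1
      then show ?thesis by (intro image_eqI[of _ _ "(False, r, \<alpha>)"]) auto
    next
      case 2
      then show ?thesis by (intro image_eqI[of _ _ "(True, r, \<alpha>)"]) auto
    qed
  next
    fix p :: "(real ^ 'n \<Rightarrow> complex) \<Rightarrow> real" assume "p \<in> ?P ` {(b, r, \<alpha>). 0 < r}"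
    then obtain b r \<alpha> where "0 < r" "p = (\<lambda>u. weighted_sup \<omega> r \<alpha> (if b then fourier u else u))" by auto
    then show "p \<in> S_seminorms \<omega>" by (cases b) (auto simp: S_seminorms_def)
  qed
  then show ?thesis
    unfolding S_topology_def
    using dominated_functionals.nuclear_space_seminorm_topology[OF dominated_functionals_S_space[OF assms, where 'n = 'n]]
    by simp
qed

end
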